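(* Let $r>r_0>0$ be real numbers, let $N>1$ and $d>k>0$ be integers, and let $P:=\{\mathbf{p}_1,\mathbf{p}_2,\dots,\mathbf{p}_N\}\subset\mathbb{E}^d$ be a set of points whose circumradius is $r_{cr}(P)=r_0$. Then $$V_k(P^r)\leq V_k\left(L_{r,\;r-\sqrt{\frac{d+1}{2d}}\,r_0,\;d}\right).$$
   Context: $\mathbb{E}^d$ is $d$-dimensional Euclidean space and $\mathbf{B}^d[\mathbf{p},r]$ is the closed ball of radius $r$ centered at $\mathbf{p}$; $\mathbf{o}$ is the origin. $V_d$ is $d$-dimensional Lebesgue measure, and for a compact convex set $A\subset\mathbb{E}^d$ and $0\leq k<d$, $V_k(A)$ is the $k$th intrinsic volume of $A$, defined by the Steiner formula $V_d(A+\epsilon\mathbf{B}^d[\mathbf{o},1])=\sum_{i=0}^d\omega_{d-i}V_i(A)\epsilon^{d-i}$ for all $\epsilon\ge 0$, where $\omega_j=\pi^{j/2}/\Gamma(1+j/2)$ is the volume of the $j$-dimensional unit ball. For a nonempty set $X\subseteq\mathbb{E}^d$ and $r>0$, the $r$-ball body generated by $X$ is $X^r:=\bigcap_{\mathbf{x}\in X}\mathbf{B}^d[\mathbf{x},r]$. The circumradius $r_{cr}(X)$ of a bounded set $X$ is the radius of the smallest closed ball containing $X$; the inradius of a convex body is the radius of the largest ball contained in it. An $r$-lense is an intersection of two closed balls of radius $r$ in $\mathbb{E}^d$. For $r\geq\rho>0$, $L_{r,\rho,d}$ denotes an $r$-lense in $\mathbb{E}^d$ whose inradius is $\rho$ (unique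 up to congruence: the centers of the two balls are at distance $2(r-\rho)$). *)

theory Defs
  imports "HOL-Analysis.Analysis"
begin

definition ball_body :: "real \<Rightarrow> 'a::metric_space set \<Rightarrow> 'a set" where
  "ball_body r X = (\<Inter>x\<in>X. cball x r)"

text \<open>The constraint \<open>0 \<le> R\<close> is needed because balls of negative radius are empty.\<close>

definition circumradius :: "'a::metric_space set \<Rightarrow> real" where
  "circumradius X = Inf {R. 0 \<le> R \<and> (\<exists>c. X \<subseteq> cball c R)}"

definition inradius :: "'a::metric_space set \<Rightarrow> real" where
  "inradius K = Sup {s. 0 \<le> s \<and> (\<exists>c. cball c s \<subseteq> K)}"

definition is_lens :: "real \<Rightarrow> 'a::metric_space set \<Rightarrow> bool" where
  "is_lens r L \<longleftrightarrow> (\<exists>a b. L = cball a r \<inter> cball b r)"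

text \<open>The inradius is only meaningful for convex bodies, i.e. for lenses with nonempty interior:
  the supremum defining it is unspecified for the empty set.\<close>

definition lens_of_inradius :: "real \<Rightarrow> real \<Rightarrow> 'a::metric_space set \<Rightarrow> bool" where
  "lens_of_inradius r \<rho> L \<longleftrightarrow> is_lens r L \<and> interior L \<noteq> {} \<and> inradius L = \<rho>"

text \<open>\<open>V\<close> is the sequence of coefficients in the Steiner formula of \<open>A\<close>; note that
  \<^term>\<open>unit_ball_vol (real j)\<close> is the volume of the \<open>j\<close>-dimensional unit ball.
  Only the values \<open>V i\<close> with \<open>i \<le> DIM('a)\<close> are constrained.\<close>

definition steiner_coefficients :: "'a::euclidean_space set \<Rightarrow> (nat \<Rightarrow> real) \<Rightarrow> bool" where
  "steiner_coefficients A V \<longleftrightarrow>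
     (\<forall>\<epsilon>\<ge>0. measure lebesgue {a + \<epsilon> *\<^sub>R b | a b. a \<in> A \<and> b \<in> cball 0 1} =
        (\<Sum>i = 0..DIM('a). unit_ball_vol (real (DIM('a) - i)) * V i * \<epsilon> ^ (DIM('a) - i)))"

definition intrinsic_volume :: "nat \<Rightarrow> 'a::euclidean_space set \<Rightarrow> real" where
  "intrinsic_volume k A = (THE v. \<exists>V. steiner_coefficients A V \<and> v = V k)"

text \<open>Coefficients in the Steiner formula are unique, so the definite description above is
  justified for every set that satisfies a Steiner formula.\<close>

lemma steiner_coefficients_unique:
  fixes A :: "'a::euclidean_space set"
  assumes "steiner_coefficients A V" "steiner_coefficients A W" "k \<le> DIM('a)"
  shows "V k = W k"
proof -
  let ?d = "DIM('a)"
  define c where "c j = unit_ball_vol (real j) * (V (?d - j) - W (?d - j))" for j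
  have rev: "(\<Sum>i = 0..?d. unit_ball_vol (real (?d - i)) * U i * e ^ (?d - i)) =
      (\<Sum>j\<le>?d. unit_ball_vol (real j) * U (?d - j) * e ^ j)" for U :: "nat \<Rightarrow> real" and e
    by (rule sum.reindex_bij_witness[where i = "\<lambda>j. ?d - j" and j = "\<lambda>j. ?d - j"]) auto
  have "(\<Sum>j\<le>?d. c j * e ^ j) = 0" if "e \<ge> 0" for e :: real
    using assms(1,2) that unfolding steiner_coefficients_def rev c_def
    by (simp add: algebra_simps sum_subtractf)
  then have "{0..} \<subseteq> {e::real. (\<Sum>j\<le>?d. c j * e ^ j) = 0}"
    by auto
  then have "infinite {e::real. (\<Sum>j\<le>?d. c j * e ^ j) = 0}"
    using infinite_Ici finite_subset by blast
  then have "c (?d - k) = 0"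
    using polyfun_finite_roots[of c ?d] diff_le_self by blast
  moreover have "unit_ball_vol (real (?d - k)) \<noteq> 0"
    by (rule less_imp_neq[OF unit_ball_vol_pos, symmetric]) simp
  ultimately show ?thesis
    using assms(3) by (simp add: c_def)
qed

lemma intrinsic_volume_eqI:
  fixes A :: "'a::euclidean_space set"
  assumes "steiner_coefficients A V" "k \<le> DIM('a)"
  shows "intrinsic_volume k A = V k"
  unfolding intrinsic_volume_def
  using assms steiner_coefficients_unique by (intro the_equality) blast+

text \<open>A lens of inradius \<open>\<rho>\<close> exists whenever \<open>0 < \<rho> \<le> r\<close>, and its two balls
  have centers at distance \<open>2 * (r - \<rho>)\<close>, so that it is unique up to congruence.\<close>

lemma inradius_lens:
  fixes a b :: "'a::euclidean_space"
  assumes "dist a b \<le> 2 * r"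
  shows "inradius (cball a r \<inter> cball b r) = r - dist a b / 2"
  unfolding inradius_def
proof (rule cSup_eq_maximum)
  have "dist (midpoint a b) a = dist a b / 2" "dist (midpoint a b) b = dist a b / 2"
    by (simp_all add: dist_midpoint)
  then have "cball (midpoint a b) (r - dist a b / 2) \<subseteq> cball a r \<inter> cball b r"
    by (simp add: cball_subset_cball_iff)
  then show "r - dist a b / 2 \<in> {s. 0 \<le> s \<and> (\<exists>c. cball c s \<subseteq> cball a r \<inter> cball b r)}"
    using assms by auto
next
  fix s assume "s \<in> {s. 0 \<le> s \<and> (\<exists>c. cball c s \<subseteq> cball a r \<inter> cball b r)}"
  then obtain c where "0 \<le> s" "dist c a + s \<le> r" "dist c b + s \<le> r"
    by (auto simp: cball_subset_cball_iff)
  then show "s \<le> r - dist a b / 2"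
    using dist_triangle3[of a b c] by linarith
qed

lemma lens_of_inradius_iff:
  fixes L :: "'a::euclidean_space set"
  assumes "0 < \<rho>"
  shows "lens_of_inradius r \<rho> L \<longleftrightarrow>
    (\<exists>a b. L = cball a r \<inter> cball b r \<and> dist a b = 2 * (r - \<rho>))"
proof
  assume L: "lens_of_inradius r \<rho> L"
  then obtain a b where ab: "L = cball a r \<inter> cball b r"
    by (auto simp: lens_of_inradius_def is_lens_def)
  obtain x where "x \<in> L"
    using L interior_subset by (fastforce simp: lens_of_inradius_def)
  then have "dist a b \<le> 2 * r"
    using ab dist_triangle2[of a b x] by simp
  then have "inradius L = r - dist a b / 2"
    using ab inradius_lens by blast
  then have "dist a b = 2 * (r - \<rho>)"
    using L by (simp add: lens_of_inradius_def)
  then show "\<exists>a b. L = cball a r \<inter> cball b r \<and> dist a b = 2 * (r - \<rho>)"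
    using ab by blast
next
  assume "\<exists>a b. L = cball a r \<inter> cball b r \<and> dist a b = 2 * (r - \<rho>)"
  then obtain a b where ab: "L = cball a r \<inter> cball b r" "dist a b = 2 * (r - \<rho>)"
    by blast
  have "dist (midpoint a b) a = r - \<rho>" "dist (midpoint a b) b = r - \<rho>"
    using ab(2) by (simp_all add: dist_midpoint)
  then have "cball (midpoint a b) \<rho> \<subseteq> L"
    by (simp add: ab(1) cball_subset_cball_iff)
  then have "ball (midpoint a b) \<rho> \<subseteq> interior L"
    by (meson ball_subset_cball interior_maximal open_ball subset_trans)
  then have "interior L \<noteq> {}"
    using assms centre_in_ball by blast
  moreover have "inradius L = \<rho>"
    using assms ab inradius_lens[of a b r] by (simp add: field_simps)
  ultimately show "lens_of_inradius r \<rho> L"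
    using ab(1) by (auto simp: lens_of_inradius_def is_lens_def)
qed

lemma lens_of_inradius_exists:
  assumes "0 < \<rho>" "\<rho> \<le> r"
  shows "\<exists>L :: 'a::euclidean_space set. lens_of_inradius r \<rho> L"
proof -
  obtain b :: 'a where "dist 0 b = 2 * (r - \<rho>)"
    using vector_choose_size[of "2 * (r - \<rho>)"] assms by (auto simp: dist_norm)
  then show ?thesis
    using lens_of_inradius_iff[OF assms(1)] by blast
qed

end

theory Submission
  imports Defs
begin

text \<open>
  By Jung's theorem a set of circumradius \<open>r0\<close> in dimension \<open>d\<close> contains two points at distance at
  least \<open>2 * \<sigma>\<close>, where \<open>\<sigma> = sqrt ((d + 1) / (2 * d)) * r0\<close>.  The ball body lies in the lens
  generated by these two points, which lies in a lens whose centres are at distance exactly \<open>2 * \<sigma>\<close>,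
  that is, in a congruent copy of the given lens.  It remains to know that intrinsic volumes exist,
  are monotone under inclusion of convex bodies, and are invariant under congruence.

  Existence (Steiner's formula) and monotonicity are proved together.  The key observation is that
  \<open>s \<mapsto> vol (K + s * I)\<close> is affine for a convex body \<open>K\<close> and a segment \<open>I\<close>, because
  lengthening the segment by a given amount adds a translate of one and the same layer, however long
  it was before (\<open>measure_add_segment\<close>).  The
  slope of this function is again affine along segments, and it is monotone in \<open>K\<close> because an affine
  function that stays below another one has no larger slope (\<open>segment_affine_increment\<close>).
  Iterating, \<open>vol (K + \<epsilon> * Z)\<close> is for every zonotope \<open>Z\<close>, a sum of segments, a polynomial in \<open>\<epsilon>\<close> whose
  coefficients are nonnegative and monotone in \<open>K\<close>; growth bounds its degree by \<open>d\<close>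
  (\<open>measure_add_zonotope_polynomial\<close>).

  Finally the unit ball is a limit of zonotopes (\<open>zonotope_between_balls\<close>): by rotation invariance
  the integral of \<open>\<bar>u \<bullet> y\<bar>\<close> over \<open>y\<close> in the ball is a multiple of \<open>norm u\<close>, the support function of a
  ball, and its Riemann sums are support functions of zonotopes.  Steiner's formula and the
  monotonicity of its coefficients survive the limit (\<open>steiner_formula_mono\<close>).
\<close>

section \<open>Invariance of Lebesgue measure under orthogonal maps\<close>

lemma continuous_on_orthogonal_transformation:
  fixes f :: "'a::euclidean_space \<Rightarrow> 'a"
  assumes "orthogonal_transformation f"
  shows "continuous_on S f"
  using orthogonal_transformation_linear[OF assms]
  by (intro linear_continuous_on) (simp add: linear_conv_bounded_linear)

text \<open>By the Vitali covering theorem an open set is, up to a null set, a countable disjoint union of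
balls, and an orthogonal map carries balls to balls of the same radius.  Hence it cannot decrease
the measure of an open set; applied to the map and to its inverse this gives equality on boxes.\<close>

lemma lborel_distr_orthogonal_transformation:
  fixes f :: "'a::euclidean_space \<Rightarrow> 'a"
  assumes "orthogonal_transformation f"
  shows "distr lborel borel f = lborel"
proof -
  have image_ge: "emeasure lborel U \<le> emeasure lborel (g ` U)"
    if g: "orthogonal_transformation g" and U: "open U" "open (g ` U)"
    for g :: "'a \<Rightarrow> 'a" and U
  proof -
    define K where "K = {(x, s). 0 < s \<and> ball x s \<subseteq> U}"
    have "\<exists>i. i \<in> K \<and> x \<in> ball (fst i) (snd i) \<and> snd i < e" if "x \<in> U" "0 < e" for x e
    proof -
      obtain s where s: "0 < s" "ball x s \<subseteq> U"
        using U(1) \<open>x \<in> U\<close> openE by blast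
      have "ball x (min s (e / 2)) \<subseteq> U"
        using s(2) by auto
      then show ?thesis
        using s(1) \<open>0 < e\<close> by (intro exI[of _ "(x, min s (e / 2))"]) (auto simp: K_def)
    qed
    then obtain C where C: "countable C" "C \<subseteq> K"
      "pairwise (\<lambda>i j. disjnt (ball (fst i) (snd i)) (ball (fst j) (snd j))) C"
      "negligible (U - (\<Union>i\<in>C. ball (fst i) (snd i)))"
      by (rule Vitali_covering_theorem_balls[of U K fst snd])
    define B where "B i = ball (fst i) (snd i)" for i :: "'a \<times> real"
    have disj: "disjoint_family_on B C"
      using C(3) unfolding disjoint_family_on_def pairwise_def disjnt_def B_def by auto
    have disj': "disjoint_family_on (\<lambda>i. g ` B i) C"
      using disj orthogonal_transformation_inj[OF g]
      unfolding disjoint_family_on_def by (metis image_Int image_empty)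
    have gB: "g ` B i = ball (g (fst i)) (snd i)" for i
      unfolding B_def using g by (rule image_orthogonal_transformation_ball)
    have openB: "open (\<Union>(B ` C))"
      by (auto simp: B_def)
    have "U \<subseteq> \<Union>(B ` C) \<union> (U - \<Union>(B ` C))"
      by auto
    then have "emeasure lborel U \<le> emeasure lborel (\<Union>(B ` C) \<union> (U - \<Union>(B ` C)))"
      using U(1) openB by (intro emeasure_mono) auto
    also have "\<dots> = emeasure lborel (\<Union>(B ` C))"
    proof (rule emeasure_Un_null_set)
      have "U - \<Union>(B ` C) \<in> null_sets lebesgue"
        using C(4) by (simp add: B_def negligible_iff_null_sets)
      moreover have "U - \<Union>(B ` C) \<in> sets borel"
        using U(1) openB by auto
      ultimately show "U - \<Union>(B ` C) \<in> null_sets lborel"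
        by (simp add: null_sets_def)
    qed (use openB in auto)
    also have "\<dots> = (\<integral>\<^sup>+i. emeasure lborel (B i) \<partial>count_space C)"
      using C(1) disj by (intro emeasure_UN_countable) (auto simp: B_def)
    also have "\<dots> = (\<integral>\<^sup>+i. emeasure lborel (g ` B i) \<partial>count_space C)"
    proof (intro nn_integral_cong)
      fix i assume "i \<in> space (count_space C)"
      then have "0 < snd i"
        using C(2) by (auto simp: K_def)
      then show "emeasure lborel (B i) = emeasure lborel (g ` B i)"
        unfolding gB by (simp add: B_def emeasure_ball)
    qed
    also have "\<dots> = emeasure lborel (\<Union>i\<in>C. g ` B i)"
      using C(1) disj' by (intro emeasure_UN_countable[symmetric]) (auto simp: gB)
    also have "\<dots> \<le> emeasure lborel (g ` U)"
    proof (rule emeasure_mono)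
      have "B i \<subseteq> U" if "i \<in> C" for i
        using subsetD[OF C(2) that] by (cases i) (auto simp: K_def B_def)
      then show "(\<Union>i\<in>C. g ` B i) \<subseteq> g ` U"
        by blast
      show "g ` U \<in> sets lborel"
        using U(2) by simp
    qed
    finally show ?thesis .
  qed
  have bij: "bij f"
    using assms by (rule orthogonal_transformation_bij)
  have inv: "orthogonal_transformation (inv f)"
    using assms by (rule orthogonal_transformation_inv)
  have contf: "continuous_on UNIV f"
    using assms by (rule continuous_on_orthogonal_transformation)
  have f_meas: "f \<in> borel_measurable borel"
    using contf by (rule borel_measurable_continuous_onI)
  have "lborel = distr lborel borel f"
  proof (rule lborel_eqI)
    fix l u :: 'a assume lu: "\<And>b. b \<in> Basis \<Longrightarrow> l \<bullet> b \<le> u \<bullet> b"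
    have vim: "f -` box l u = inv f ` box l u"
      by (rule bij_vimage_eq_inv_image[OF bij])
    have op: "open (f -` box l u)"
      using contf open_vimage by blast
    have im: "f ` (f -` box l u) = box l u"
      using bij by (simp add: bij_is_surj surj_image_vimage_eq)
    have "emeasure lborel (f -` box l u) = emeasure lborel (box l u)"
    proof (rule antisym)
      show "emeasure lborel (f -` box l u) \<le> emeasure lborel (box l u)"
        using image_ge[OF assms op] open_box unfolding im by metis
      show "emeasure lborel (box l u) \<le> emeasure lborel (f -` box l u)"
        using image_ge[OF inv, of "box l u"] op open_box unfolding vim by metis
    qed
    then show "emeasure (distr lborel borel f) (box l u) = (\<Prod>b\<in>Basis. (u - l) \<bullet> b)"
      using lu f_meas by (simp add: emeasure_distr emeasure_lborel_box_eq)
  qed simp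
  then show ?thesis ..
qed

lemma measure_orthogonal_transformation_compact:
  fixes f :: "'a::euclidean_space \<Rightarrow> 'a"
  assumes "orthogonal_transformation f" "compact S"
  shows "measure lebesgue (f ` S) = measure lebesgue S"
proof -
  have contf: "continuous_on UNIV f"
    using assms(1) by (rule continuous_on_orthogonal_transformation)
  have comp: "compact (f ` S)"
    using assms(2) contf continuous_on_subset by (intro compact_continuous_image) blast+
  have "measure lborel (f ` S) = measure (distr lborel borel f) (f ` S)"
    using lborel_distr_orthogonal_transformation[OF assms(1)] by simp
  also have "\<dots> = measure lborel (f -` f ` S)"
    using comp contf by (subst measure_distr) (auto intro: borel_measurable_continuous_onI borel_compact)
  also have "f -` f ` S = S"
    using orthogonal_transformation_inj[OF assms(1)] by (rule inj_vimage_image_eq)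
  finally show ?thesis
    using comp assms(2) by (simp add: borel_compact)
qed

text \<open>The witness is the reflection in the hyperplane orthogonal to \<open>a - b\<close>; when \<open>a = b\<close> its formula
divides by zero and degenerates to the identity, which is the map needed then.\<close>

lemma orthogonal_transformation_exists_equal_norm:
  fixes a b :: "'a::euclidean_space"
  assumes "norm a = norm b"
  obtains f where "orthogonal_transformation f" "f a = b"
proof
  define v where "v = a - b"
  define f where "f x = x - (2 * (x \<bullet> v) / (v \<bullet> v)) *\<^sub>R v" for x
  have "linear f"
    by (rule linearI) (simp_all add: f_def inner_add_left algebra_simps add_divide_distrib)
  moreover have "norm (f x) = norm x" for x
  proof (cases "v = 0")
    case False
    have "f x \<bullet> f x = x \<bullet> x - 4 * (x \<bullet> v)\<^sup>2 / (v \<bullet> v) + (2 * (x \<bullet> v) / (v \<bullet> v))\<^sup>2 * (v \<bullet> v)"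
      by (simp add: f_def inner_diff_left inner_diff_right power2_eq_square algebra_simps inner_commute)
    also have "\<dots> = x \<bullet> x"
      using False by (simp add: power2_eq_square field_simps)
    finally show ?thesis
      by (simp add: norm_eq_sqrt_inner)
  qed (simp add: f_def)
  ultimately show "orthogonal_transformation f"
    by (simp add: orthogonal_transformation)
  have "a \<bullet> a = b \<bullet> b"
    using assms by (metis power2_norm_eq_inner)
  then have "2 * (a \<bullet> v) = v \<bullet> v"
    by (simp add: v_def inner_diff_left inner_diff_right inner_commute)
  then show "f a = b"
    by (cases "v = 0") (auto simp: f_def v_def)
qed

section \<open>Volume and Minkowski sums with segments\<close>

text \<open>Cauchy's functional equation on the half-line.  Monotonicity traps \<open>n * f x\<close> and \<open>n * x * f 1\<close>
between the same two consecutive multiples of \<open>f 1\<close>, for every \<open>n\<close>.\<close>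

lemma additive_mono_linear:
  fixes f :: "real \<Rightarrow> real"
  assumes add: "\<And>x y. 0 \<le> x \<Longrightarrow> 0 \<le> y \<Longrightarrow> f (x + y) = f x + f y"
    and mono: "\<And>x y. 0 \<le> x \<Longrightarrow> x \<le> y \<Longrightarrow> f x \<le> f y"
    and "0 \<le> x"
  shows "f x = x * f 1"
proof -
  have f0: "f 0 = 0"
    using add[of 0 0] by simp
  have nat_mult: "f (real n * y) = real n * f y" if "0 \<le> y" for n y
    using that by (induction n) (simp_all add: f0 add algebra_simps)
  have f1: "0 \<le> f 1"
    using mono[of 0 1] f0 by simp
  have close: "real n * \<bar>f x - x * f 1\<bar> \<le> f 1" for n :: nat
  proof -
    define m where "m = nat \<lfloor>real n * x\<rfloor>"
    have m: "real m \<le> real n * x" "real n * x \<le> real m + 1"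
      using \<open>0 \<le> x\<close> by (simp_all add: m_def of_nat_floor)
    have "real m * f 1 \<le> real n * f x" "real n * f x \<le> (real m + 1) * f 1"
      using mono[OF _ m(1)] mono[OF _ m(2)] nat_mult[of x n] nat_mult[of 1 m] nat_mult[of 1 "Suc m"]
        \<open>0 \<le> x\<close> by (simp_all add: algebra_simps)
    moreover have "real m * f 1 \<le> real n * x * f 1" "real n * x * f 1 \<le> (real m + 1) * f 1"
      using m f1 by (simp_all add: mult_right_mono)
    ultimately have "\<bar>real n * f x - real n * x * f 1\<bar> \<le> f 1"
      by (simp add: algebra_simps abs_le_iff)
    moreover have "real n * \<bar>f x - x * f 1\<bar> = \<bar>real n * f x - real n * x * f 1\<bar>"
      using abs_mult[of "real n" "f x - x * f 1"] by (simp add: right_diff_distrib mult.assoc)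
    ultimately show ?thesis by simp
  qed
  have "\<bar>f x - x * f 1\<bar> \<le> 0"
  proof (rule ccontr)
    assume "\<not> \<bar>f x - x * f 1\<bar> \<le> 0"
    then obtain n :: nat where "f 1 < real n * \<bar>f x - x * f 1\<bar>"
      using reals_Archimedean3[of "\<bar>f x - x * f 1\<bar>"] by auto
    then show False
      using close[of n] by linarith
  qed
  then show ?thesis by simp
qed

definition symmetric_segment :: "'a::real_vector \<Rightarrow> 'a set" where
  "symmetric_segment u = closed_segment (- u) u"

lemma convex_symmetric_segment [simp]: "convex (symmetric_segment u)"
  by (simp add: symmetric_segment_def)

lemma compact_symmetric_segment [simp]: "compact (symmetric_segment (u :: 'a::euclidean_space))"
  by (simp add: symmetric_segment_def)

lemma zero_in_symmetric_segment [simp]: "0 \<in> symmetric_segment u"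
  unfolding symmetric_segment_def in_segment
  by (intro exI[of _ "1 / 2"]) (simp add: algebra_simps)

lemma symmetric_segment_scaleR:
  "symmetric_segment (c *\<^sub>R u) = (*\<^sub>R) c ` symmetric_segment u"
  by (simp add: symmetric_segment_def flip: closed_segment_linear_image[OF linear_scaleR])

lemma compact_set_plus:
  fixes S T :: "'a::real_normed_vector set"
  assumes "compact S" "compact T"
  shows "compact (S + T)"
proof -
  have "S + T = {x + y |x y. x \<in> S \<and> y \<in> T}"
    by (auto simp: set_plus_def)
  then show ?thesis
    using compact_sums[OF assms] by simp
qed

lemma measure_lebesgue_mono_compact:
  fixes S T :: "'a::euclidean_space set"
  assumes "compact S" "compact T" "S \<subseteq> T"
  shows "measure lebesgue S \<le> measure lebesgue T"
  using assms by (simp add: lmeasurable_compact fmeasurableD measure_mono_fmeasurable)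

text \<open>On a line parallel to \<open>u\<close> a convex set is an interval, and adding a segment in direction \<open>u\<close> moves
only its upper end.  So the layer gained between the lengths \<open>s\<close> and \<open>s + t\<close> is a translate of the
layer gained between \<open>0\<close> and \<open>t\<close>.  Convexity alone shows this, without integrating over the lines.\<close>

lemma measure_add_segment_diff:
  fixes K :: "'a::euclidean_space set" and u :: 'a
  assumes K: "compact K" "convex K" and "0 \<le> s" "0 \<le> t"
  defines "M \<equiv> \<lambda>r. K + closed_segment 0 (r *\<^sub>R u)"
  shows "measure lebesgue (M (s + t)) - measure lebesgue (M s) =
    measure lebesgue (M t) - measure lebesgue (M 0)"
proof -
  have memM: "x \<in> M r \<longleftrightarrow> (\<exists>c. 0 \<le> c \<and> c \<le> r \<and> x - c *\<^sub>R u \<in> K)" if "0 \<le> r" for x r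
  proof
    assume "x \<in> M r"
    then obtain k c where "k \<in> K" "0 \<le> c" "c \<le> 1" "x = k + c *\<^sub>R r *\<^sub>R u"
      by (auto simp: M_def in_segment elim!: set_plus_elim)
    then show "\<exists>c. 0 \<le> c \<and> c \<le> r \<and> x - c *\<^sub>R u \<in> K"
      using that by (intro exI[of _ "c * r"]) (auto simp: mult_left_le_one_le)
  next
    assume "\<exists>c. 0 \<le> c \<and> c \<le> r \<and> x - c *\<^sub>R u \<in> K"
    then obtain c where c: "0 \<le> c" "c \<le> r" "x - c *\<^sub>R u \<in> K" by blast
    have "c *\<^sub>R u \<in> closed_segment 0 (r *\<^sub>R u)"
      using c that unfolding in_segment by (intro exI[of _ "c / r"]) auto
    then have "(x - c *\<^sub>R u) + c *\<^sub>R u \<in> M r"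
      unfolding M_def using c(3) by (intro set_plus_intro)
    then show "x \<in> M r" by simp
  qed
  have comp: "compact (M r)" for r
    unfolding M_def using K(1) by (simp add: compact_set_plus)
  have mono: "M r \<subseteq> M r'" if "0 \<le> r" "r \<le> r'" for r r'
    using that memM by fastforce
  have M0: "M 0 = K"
  proof (intro set_eqI)
    show "x \<in> M 0 \<longleftrightarrow> x \<in> K" for x
      unfolding memM[OF order_refl] by (metis order_refl order_antisym scale_zero_left diff_zero)
  qed
  have shift: "M (s + t) - M s = (+) (s *\<^sub>R u) ` (M t - M 0)"
  proof (intro set_eqI iffI)
    fix x assume x: "x \<in> M (s + t) - M s"
    then obtain c where c: "0 \<le> c" "c \<le> s + t" "x - c *\<^sub>R u \<in> K"
      using memM[of "s + t"] assms by auto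
    have "s < c"
      using x c memM[OF \<open>0 \<le> s\<close>] by force
    then have "x - s *\<^sub>R u \<in> M t"
      using c memM[OF \<open>0 \<le> t\<close>] by (intro iffD2[OF memM[OF \<open>0 \<le> t\<close>]] exI[of _ "c - s"]) (auto simp: algebra_simps)
    moreover have "x - s *\<^sub>R u \<notin> K"
      using x memM[OF \<open>0 \<le> s\<close>] \<open>0 \<le> s\<close> by blast
    ultimately show "x \<in> (+) (s *\<^sub>R u) ` (M t - M 0)"
      using M0 by (intro image_eqI[of _ _ "x - s *\<^sub>R u"]) auto
  next
    fix x assume "x \<in> (+) (s *\<^sub>R u) ` (M t - M 0)"
    then obtain y where y: "x = s *\<^sub>R u + y" "y \<in> M t" "y \<notin> K"
      using M0 by auto
    then obtain c where c: "0 \<le> c" "c \<le> t" "y - c *\<^sub>R u \<in> K"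
      using memM[OF \<open>0 \<le> t\<close>] by auto
    have "x \<in> M (s + t)"
      using c y \<open>0 \<le> s\<close> \<open>0 \<le> t\<close>
      by (intro iffD2[OF memM] exI[of _ "s + c"]) (auto simp: algebra_simps)
    moreover have "x \<notin> M s"
    proof
      assume "x \<in> M s"
      then obtain c' where c': "0 \<le> c'" "c' \<le> s" "x - c' *\<^sub>R u \<in> K"
        using memM[OF \<open>0 \<le> s\<close>] by auto
      define a where "a = s - c'"
      have a: "0 \<le> a" "y + a *\<^sub>R u \<in> K"
        using c' y by (auto simp: a_def algebra_simps)
      show False
      proof (cases "a + c = 0")
        case True
        then have "a = 0" using a c by linarith
        then show False using a y by simp
      next
        case False
        \<comment> \<open>\<open>y\<close> lies on the line between two points of \<open>K\<close>, one on either side.\<close>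
        have "y = (a / (a + c)) *\<^sub>R (y - c *\<^sub>R u) + (c / (a + c)) *\<^sub>R (y + a *\<^sub>R u)"
          using False by (simp add: algebra_simps flip: add_divide_distrib scaleR_add_left)
        also have "\<dots> \<in> K"
          using a c False K(2) by (intro convexD) (auto simp flip: add_divide_distrib)
        finally show False using y by simp
      qed
    qed
    ultimately show "x \<in> M (s + t) - M s" by blast
  qed
  have diff: "measure lebesgue (M r') - measure lebesgue (M r) = measure lebesgue (M r' - M r)"
    if "0 \<le> r" "r \<le> r'" for r r'
    using measurable_measure_Diff[of "M r'" lebesgue "M r"] comp mono[OF that]
    by (simp add: lmeasurable_compact fmeasurableD)
  show ?thesis
    using diff[of s "s + t"] diff[of 0 t] assms(3,4) shift measure_translation[of "s *\<^sub>R u" "M t - M 0"]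
    by simp
qed

lemma measure_add_segment:
  fixes K :: "'a::euclidean_space set"
  assumes K: "compact K" "convex K" and "0 \<le> s"
  shows "measure lebesgue (K + closed_segment 0 (s *\<^sub>R u)) =
    measure lebesgue K + s * (measure lebesgue (K + closed_segment 0 u) - measure lebesgue K)"
proof -
  define M where "M = (\<lambda>r. K + closed_segment 0 (r *\<^sub>R u))"
  define f where "f r = measure lebesgue (M r) - measure lebesgue (M 0)" for r
  have M0: "M 0 = K"
    by (simp add: M_def set_zero)
  have sub: "M r \<subseteq> M r'" if "0 \<le> r" "r \<le> r'" for r r'
  proof -
    have "closed_segment 0 (r *\<^sub>R u) \<subseteq> closed_segment 0 (r' *\<^sub>R u)"
      using that by (auto simp: subset_closed_segment in_segment divide_le_eq_1 intro!: exI[of _ "r / r'"])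
    then show ?thesis
      unfolding M_def by (intro set_plus_mono2 order_refl)
  qed
  have comp: "compact (M r)" for r
    unfolding M_def using K(1) by (simp add: compact_set_plus)
  have "f s = s * f 1"
  proof (rule additive_mono_linear)
    show "f (x + y) = f x + f y" if "0 \<le> x" "0 \<le> y" for x y
      using measure_add_segment_diff[OF K that, of u] by (simp add: f_def M_def)
    show "f x \<le> f y" if "0 \<le> x" "x \<le> y" for x y
      using measure_lebesgue_mono_compact[OF comp comp sub[OF that]] by (simp add: f_def)
  qed fact
  then show ?thesis
    using M0 by (simp add: f_def M_def)
qed

text \<open>The class of functionals on convex bodies that the induction over the segments of a zonotope runs
through.  It is chosen so as to contain the volume and to be closed under passing to the increment
caused by a segment; monotonicity is part of it because this is what the coefficients of the
Steiner polynomial inherit.\<close>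

definition segment_affine :: "('a::euclidean_space set \<Rightarrow> real) \<Rightarrow> bool" where
  "segment_affine \<phi> \<longleftrightarrow>
    (\<forall>K. compact K \<and> convex K \<longrightarrow> 0 \<le> \<phi> K) \<and>
    (\<forall>K L. compact K \<and> convex K \<and> compact L \<and> convex L \<and> K \<subseteq> L \<longrightarrow> \<phi> K \<le> \<phi> L) \<and>
    (\<forall>K u s. compact K \<and> convex K \<and> 0 \<le> s \<longrightarrow>
      \<phi> (K + symmetric_segment (s *\<^sub>R u)) = \<phi> K + s * (\<phi> (K + symmetric_segment u) - \<phi> K))"

lemma segment_affine_measure: "segment_affine (measure lebesgue :: 'a::euclidean_space set \<Rightarrow> real)"
proof -
  have "measure lebesgue (K + symmetric_segment u) =
      measure lebesgue (K + closed_segment 0 (2 *\<^sub>R u))" for K and u :: 'a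
  proof -
    have "closed_segment 0 (2 *\<^sub>R u) = (+) u ` symmetric_segment u"
      by (simp add: symmetric_segment_def scaleR_2 flip: closed_segment_translation)
    then have "K + closed_segment 0 (2 *\<^sub>R u) = (+) u ` (K + symmetric_segment u)"
      by (force simp: set_plus_def image_iff algebra_simps)
    then show ?thesis
      by (simp add: measure_translation)
  qed
  moreover have "measure lebesgue (K + closed_segment 0 (2 *\<^sub>R s *\<^sub>R u)) =
      measure lebesgue K + s * (measure lebesgue (K + closed_segment 0 (2 *\<^sub>R u)) - measure lebesgue K)"
    if "compact K" "convex K" "0 \<le> s" for K s and u :: 'a
    using measure_add_segment[OF that, of "2 *\<^sub>R u"] by (simp only: scaleR_left_commute)
  ultimately show ?thesis
    unfolding segment_affine_def by (simp add: measure_lebesgue_mono_compact del: scaleR_scaleR)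
qed

text \<open>The increment is the slope of the affine function \<open>s \<mapsto> \<phi> (K + symmetric_segment (s *\<^sub>R u))\<close>.  If
\<open>K \<subseteq> L\<close>, the function of \<open>K\<close> stays below that of \<open>L\<close> for all \<open>s\<close>, so its slope cannot be larger.
This yields monotonicity of mixed volumes without any integral formula for them.\<close>

lemma segment_affine_increment:
  fixes \<phi> :: "'a::euclidean_space set \<Rightarrow> real"
  assumes "segment_affine \<phi>"
  shows "segment_affine (\<lambda>K. \<phi> (K + symmetric_segment u) - \<phi> K)"
proof -
  define \<psi> where "\<psi> K = \<phi> (K + symmetric_segment u) - \<phi> K" for K
  have body: "compact (K + symmetric_segment v)" "convex (K + symmetric_segment v)"
    if "compact K" "convex K" for K and v :: 'a
    using that by (simp_all add: compact_set_plus convex_set_plus)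
  have nonneg: "0 \<le> \<phi> K" if "compact K" "convex K" for K
    using assms that by (simp add: segment_affine_def)
  have mono: "\<phi> K \<le> \<phi> L" if "compact K" "convex K" "compact L" "convex L" "K \<subseteq> L" for K L
    using assms that by (simp add: segment_affine_def)
  have aff: "\<phi> (K + symmetric_segment (s *\<^sub>R v)) = \<phi> K + s * (\<phi> (K + symmetric_segment v) - \<phi> K)"
    if "compact K" "convex K" "0 \<le> s" for K s v
    using assms that by (simp add: segment_affine_def)
  have sub: "K \<subseteq> K + symmetric_segment v" for K and v :: 'a
    using set_plus_intro[OF _ zero_in_symmetric_segment[of v]] by fastforce
  have "\<psi> K \<le> \<psi> L" if KL: "compact K" "convex K" "compact L" "convex L" "K \<subseteq> L" for K L
  proof (rule ccontr)
    assume "\<not> \<psi> K \<le> \<psi> L"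
    then obtain n :: nat where n: "\<phi> L < real n * (\<psi> K - \<psi> L)"
      using reals_Archimedean3[of "\<psi> K - \<psi> L"] by auto
    have "\<phi> (K + symmetric_segment (real n *\<^sub>R u)) \<le> \<phi> (L + symmetric_segment (real n *\<^sub>R u))"
      using KL by (intro mono body set_plus_mono2) auto
    then have "\<phi> K + real n * \<psi> K \<le> \<phi> L + real n * \<psi> L"
      using KL aff[of K "real n" u] aff[of L "real n" u] by (simp add: \<psi>_def)
    then show False
      using n nonneg[OF KL(1,2)] by (simp add: algebra_simps)
  qed
  moreover have "0 \<le> \<psi> K" if "compact K" "convex K" for K
    using mono[OF that body[OF that] sub] by (simp add: \<psi>_def)
  moreover have "\<psi> (K + symmetric_segment (s *\<^sub>R v)) = \<psi> K + s * (\<psi> (K + symmetric_segment v) - \<psi> K)"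
    if K: "compact K" "convex K" "0 \<le> s" for K s v
  proof -
    have "K + symmetric_segment w + symmetric_segment u = (K + symmetric_segment u) + symmetric_segment w" for w
      by (simp add: add.assoc add.commute[of "symmetric_segment u"])
    then show ?thesis
      using aff[OF body[OF K(1,2)] K(3), of u v] aff[OF K, of v]
      by (simp add: \<psi>_def algebra_simps)
  qed
  ultimately have "segment_affine \<psi>"
    by (simp add: segment_affine_def)
  then show ?thesis
    by (simp add: \<psi>_def[abs_def])
qed

lemma segment_affine_add:
  assumes "segment_affine \<phi>" "segment_affine \<psi>"
  shows "segment_affine (\<lambda>K. \<phi> K + \<psi> K)"
  using assms unfolding segment_affine_def by (auto simp: algebra_simps add_mono)

definition zonotope :: "'a::real_vector list \<Rightarrow> 'a set" where
  "zonotope zs = sum_list (map symmetric_segment zs)"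

lemma zonotope_Nil [simp]: "zonotope [] = {0}"
  by (simp add: zonotope_def set_zero)

lemma zonotope_Cons [simp]: "zonotope (z # zs) = symmetric_segment z + zonotope zs"
  by (simp add: zonotope_def)

lemma compact_zonotope: "compact (zonotope (zs :: 'a::euclidean_space list))"
  by (induction zs) (auto simp: compact_set_plus)

lemma convex_zonotope: "convex (zonotope (zs :: 'a::euclidean_space list))"
  by (induction zs) (auto simp: convex_set_plus)

lemma zonotope_scaleR: "zonotope (map ((*\<^sub>R) c) zs) = (*\<^sub>R) c ` zonotope zs"
proof (induction zs)
  case (Cons z zs)
  have "(*\<^sub>R) c ` (S + T) = (*\<^sub>R) c ` S + (*\<^sub>R) c ` T" for S T :: "'a set"
  proof (intro equalityI subsetI)
    fix x assume "x \<in> (*\<^sub>R) c ` S + (*\<^sub>R) c ` T"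
    then obtain a b where "a \<in> S" "b \<in> T" "x = c *\<^sub>R (a + b)"
      by (auto simp: scaleR_add_right elim!: set_plus_elim)
    then show "x \<in> (*\<^sub>R) c ` (S + T)"
      by (intro image_eqI set_plus_intro) auto
  next
    fix x assume "x \<in> (*\<^sub>R) c ` (S + T)"
    then obtain a b where "a \<in> S" "b \<in> T" "x = c *\<^sub>R a + c *\<^sub>R b"
      by (auto simp: scaleR_add_right elim!: set_plus_elim)
    then show "x \<in> (*\<^sub>R) c ` S + (*\<^sub>R) c ` T"
      by (auto intro!: set_plus_intro)
  qed
  then show ?case
    using Cons by (simp add: symmetric_segment_scaleR)
qed simp

text \<open>Adding the segments one at a time: by affinity, a further segment turns every old
coefficient into itself plus \<open>\<epsilon>\<close> times its increment.\<close>

lemma segment_affine_zonotope_polynomial: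
  fixes \<phi> :: "'a::euclidean_space set \<Rightarrow> real"
  assumes "segment_affine \<phi>"
  shows "\<exists>\<psi>. (\<forall>j. segment_affine (\<psi> j)) \<and>
    (\<forall>K \<epsilon>. compact K \<and> convex K \<and> 0 \<le> \<epsilon> \<longrightarrow>
      \<phi> (K + (*\<^sub>R) \<epsilon> ` zonotope zs) = (\<Sum>j\<le>length zs. \<psi> j K * \<epsilon> ^ j))"
proof (induction zs)
  case Nil
  show ?case
    using assms by (intro exI[of _ "\<lambda>_. \<phi>"]) (simp add: set_zero)
next
  case (Cons z zs)
  let ?n = "length zs"
  obtain \<psi> where \<psi>: "\<And>j. segment_affine (\<psi> j)"
    and poly: "\<And>K \<epsilon>. compact K \<Longrightarrow> convex K \<Longrightarrow> 0 \<le> \<epsilon> \<Longrightarrow>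
      \<phi> (K + (*\<^sub>R) \<epsilon> ` zonotope zs) = (\<Sum>j\<le>?n. \<psi> j K * \<epsilon> ^ j)"
    using Cons by blast
  define \<alpha> where "\<alpha> j K = (if j \<le> ?n then \<psi> j K else 0)" for j K
  \<comment> \<open>The increment of the coefficient of \<open>\<epsilon> ^ i\<close> carries one more factor \<open>\<epsilon>\<close>, hence the index shift.\<close>
  define \<beta> where "\<beta> j K = (case j of 0 \<Rightarrow> 0 | Suc i \<Rightarrow> \<psi> i (K + symmetric_segment z) - \<psi> i K)" for j K
  have zero: "segment_affine (\<lambda>K :: 'a set. 0)"
    by (simp add: segment_affine_def)
  have "segment_affine (\<alpha> j)" for j
    using \<psi>[of j] zero by (cases "j \<le> ?n") (simp_all add: \<alpha>_def[abs_def])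
  moreover have "segment_affine (\<beta> j)" for j
    using segment_affine_increment[OF \<psi>] zero by (cases j) (simp_all add: \<beta>_def[abs_def])
  moreover have "\<phi> (K + (*\<^sub>R) \<epsilon> ` zonotope (z # zs)) = (\<Sum>j\<le>Suc ?n. (\<alpha> j K + \<beta> j K) * \<epsilon> ^ j)"
    if K: "compact K" "convex K" "0 \<le> \<epsilon>" for K \<epsilon>
  proof -
    have "K + (*\<^sub>R) \<epsilon> ` zonotope (z # zs) =
        (K + symmetric_segment (\<epsilon> *\<^sub>R z)) + (*\<^sub>R) \<epsilon> ` zonotope zs"
      using zonotope_scaleR[of \<epsilon> "z # zs"] zonotope_scaleR[of \<epsilon> zs] by (simp add: add.assoc)
    also have "\<phi> \<dots> = (\<Sum>j\<le>?n. \<psi> j (K + symmetric_segment (\<epsilon> *\<^sub>R z)) * \<epsilon> ^ j)"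
      using K by (intro poly) (simp_all add: compact_set_plus convex_set_plus)
    also have "\<dots> = (\<Sum>j\<le>?n. (\<psi> j K + \<epsilon> * (\<psi> j (K + symmetric_segment z) - \<psi> j K)) * \<epsilon> ^ j)"
      using \<psi> K by (intro sum.cong) (simp_all add: segment_affine_def)
    also have "\<dots> = (\<Sum>j\<le>?n. \<alpha> j K * \<epsilon> ^ j) + (\<Sum>j\<le>?n. \<beta> (Suc j) K * \<epsilon> ^ Suc j)"
      unfolding sum.distrib[symmetric]
      by (intro sum.cong) (simp_all add: \<alpha>_def \<beta>_def algebra_simps)
    also have "(\<Sum>j\<le>?n. \<alpha> j K * \<epsilon> ^ j) = (\<Sum>j\<le>Suc ?n. \<alpha> j K * \<epsilon> ^ j)"
      by (simp add: \<alpha>_def)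
    also have "(\<Sum>j\<le>?n. \<beta> (Suc j) K * \<epsilon> ^ Suc j) = (\<Sum>j\<le>Suc ?n. \<beta> j K * \<epsilon> ^ j)"
      by (simp add: sum.atMost_Suc_shift \<beta>_def del: sum.atMost_Suc)
    finally show ?thesis
      by (simp only: sum.distrib distrib_right)
  qed
  ultimately show ?case
    by (intro exI[of _ "\<lambda>j K. \<alpha> j K + \<beta> j K"]) (simp add: segment_affine_add)
qed

section \<open>Approximation of the ball by zonotopes\<close>

lemma set_integrable_abs_inner:
  fixes u :: "'a::euclidean_space"
  assumes "S \<in> sets borel" "bounded S"
  shows "set_integrable lborel S (\<lambda>x. \<bar>u \<bullet> x\<bar>)"
proof -
  obtain c R where "S \<subseteq> cball c R"
    using assms(2) unfolding bounded_subset_cball by blast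
  moreover have "set_integrable lborel (cball c R) (\<lambda>x. \<bar>u \<bullet> x\<bar>)"
    unfolding set_integrable_def by (intro borel_integrable_compact continuous_intros) auto
  ultimately show ?thesis
    using assms(1) by (auto intro: set_integrable_subset)
qed

text \<open>The weights are the volumes of the pieces into which the balls cut \<open>S\<close>.  The point is that the same
weights serve all directions \<open>u\<close>, since the integrand has Lipschitz constant \<open>norm u\<close>.\<close>

lemma riemann_sum_abs_inner:
  fixes S :: "'a::euclidean_space set"
  assumes "finite F" "S \<in> sets borel" "bounded S" "S \<subseteq> (\<Union>y\<in>F. ball y \<eta>)"
  shows "\<exists>w. (\<forall>y. 0 \<le> w y) \<and> (\<forall>u.
    \<bar>(\<Sum>y\<in>F. w y * \<bar>u \<bullet> y\<bar>) - (LINT x:S|lborel. \<bar>u \<bullet> x\<bar>)\<bar> \<le> \<eta> * norm u * measure lborel S)"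
  using assms
proof (induction F arbitrary: S)
  case empty
  then show ?case by (intro exI[of _ "\<lambda>_. 0"]) (simp add: set_lebesgue_integral_def)
next
  case (insert y F)
  define A where "A = S \<inter> ball y \<eta>"
  define B where "B = S - ball y \<eta>"
  have AB: "A \<in> sets borel" "B \<in> sets borel" "bounded A" "bounded B" "A \<inter> B = {}" "S = A \<union> B"
    using insert.prems by (auto simp: A_def B_def intro: bounded_subset)
  have "B \<subseteq> (\<Union>y\<in>F. ball y \<eta>)"
    using insert.prems(3) by (auto simp: B_def)
  then obtain w where w: "\<And>y. 0 \<le> w y"
    "\<And>u. \<bar>(\<Sum>y\<in>F. w y * \<bar>u \<bullet> y\<bar>) - (LINT x:B|lborel. \<bar>u \<bullet> x\<bar>)\<bar> \<le> \<eta> * norm u * measure lborel B"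
    using insert.IH[of B] AB by blast
  define w' where "w' = w(y := measure lborel A)"
  have finA: "emeasure lborel A < \<infinity>" and finB: "emeasure lborel B < \<infinity>"
    using AB(3,4) emeasure_bounded_finite by blast+
  have "\<bar>(\<Sum>x\<in>insert y F. w' x * \<bar>u \<bullet> x\<bar>) - (LINT x:S|lborel. \<bar>u \<bullet> x\<bar>)\<bar> \<le>
      \<eta> * norm u * measure lborel S" for u
  proof -
    have const: "set_integrable lborel A (\<lambda>x. c)" for c :: real
      using AB(1) finA by (simp add: set_integrable_def)
    have constI: "(LINT x:A|lborel. c) = measure lborel A * c" for c :: real
      using AB(1) finA by (subst set_integral_const) auto
    have "measure lborel A * \<bar>u \<bullet> y\<bar> - (LINT x:A|lborel. \<bar>u \<bullet> x\<bar>) =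
        (LINT x:A|lborel. \<bar>u \<bullet> y\<bar> - \<bar>u \<bullet> x\<bar>)"
      using const set_integrable_abs_inner[OF AB(1,3)] by (simp add: constI)
    also have "\<bar>\<dots>\<bar> \<le> (LINT x:A|lborel. \<bar>\<bar>u \<bullet> y\<bar> - \<bar>u \<bullet> x\<bar>\<bar>)"
      using set_integral_norm_bound[of lborel A "\<lambda>x. \<bar>u \<bullet> y\<bar> - \<bar>u \<bullet> x\<bar>"] const
        set_integrable_abs_inner[OF AB(1,3)] by simp
    also have "\<dots> \<le> (LINT x:A|lborel. \<eta> * norm u)"
    proof (rule set_integral_mono)
      show "set_integrable lborel A (\<lambda>x. \<bar>\<bar>u \<bullet> y\<bar> - \<bar>u \<bullet> x\<bar>\<bar>)"
        using const set_integrable_abs_inner[OF AB(1,3)] by (intro set_integrable_abs) auto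
      fix x assume "x \<in> A"
      then have "norm (y - x) \<le> \<eta>"
        by (simp add: A_def dist_norm)
      have "\<bar>\<bar>u \<bullet> y\<bar> - \<bar>u \<bullet> x\<bar>\<bar> \<le> \<bar>u \<bullet> (y - x)\<bar>"
        by (simp add: inner_diff_right)
      also have "\<dots> \<le> norm u * norm (y - x)"
        by (rule Cauchy_Schwarz_ineq2)
      also have "\<dots> \<le> \<eta> * norm u"
        using mult_left_mono[OF \<open>norm (y - x) \<le> \<eta>\<close> norm_ge_zero[of u]] by (simp add: mult.commute)
      finally show "\<bar>\<bar>u \<bullet> y\<bar> - \<bar>u \<bullet> x\<bar>\<bar> \<le> \<eta> * norm u" .
    qed (rule const)
    finally have A: "\<bar>measure lborel A * \<bar>u \<bullet> y\<bar> - (LINT x:A|lborel. \<bar>u \<bullet> x\<bar>)\<bar> \<le>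
        \<eta> * norm u * measure lborel A"
      by (simp add: constI mult_ac)
    have "(LINT x:S|lborel. \<bar>u \<bullet> x\<bar>) = (LINT x:A|lborel. \<bar>u \<bullet> x\<bar>) + (LINT x:B|lborel. \<bar>u \<bullet> x\<bar>)"
      unfolding AB(6) using AB by (intro set_integral_Un set_integrable_abs_inner)
    moreover have "measure lborel S = measure lborel A + measure lborel B"
      unfolding AB(6) using AB finA finB by (intro measure_Union) auto
    moreover have "(\<Sum>x\<in>insert y F. w' x * \<bar>u \<bullet> x\<bar>) =
        measure lborel A * \<bar>u \<bullet> y\<bar> + (\<Sum>x\<in>F. w x * \<bar>u \<bullet> x\<bar>)"
    proof -
      have "(\<Sum>x\<in>F. w' x * \<bar>u \<bullet> x\<bar>) = (\<Sum>x\<in>F. w x * \<bar>u \<bullet> x\<bar>)"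
        using insert.hyps by (intro sum.cong) (auto simp: w'_def)
      then show ?thesis
        using insert.hyps by (simp add: w'_def)
    qed
    ultimately show ?thesis
      using A w(2)[of u] by (simp add: algebra_simps)
  qed
  moreover have "0 \<le> w' x" for x
    using w(1) by (simp add: w'_def)
  ultimately show ?case by blast
qed

text \<open>The integral is invariant under orthogonal maps applied to \<open>u\<close>, hence a function of \<open>norm u\<close>, and it is
homogeneous.  In other words, the ball is a zonoid: its support function is an average of the
support functions of segments.\<close>

lemma integral_cball_abs_inner:
  obtains c where "0 < c"
    "\<And>u :: 'a::euclidean_space. (LINT x:cball 0 1|lborel. \<bar>u \<bullet> x\<bar>) = c * norm u"
proof -
  define I where "I u = (LINT x:cball 0 1|lborel. \<bar>u \<bullet> x\<bar>)" for u :: 'a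
  obtain e :: 'a where e: "norm e = 1"
    using vector_choose_size[of 1] by auto
  have "I u = I e * norm u" for u
  proof -
    obtain f :: "'a \<Rightarrow> 'a" where f: "orthogonal_transformation f" "f u = norm u *\<^sub>R e"
      using orthogonal_transformation_exists_equal_norm[of u "norm u *\<^sub>R e"] e by auto
    have contf: "continuous_on UNIV f"
      using f(1) by (rule continuous_on_orthogonal_transformation)
    have "I (f u) = (LINT x|distr lborel borel f. indicator (cball 0 1) x *\<^sub>R \<bar>f u \<bullet> x\<bar>)"
      by (simp add: I_def set_lebesgue_integral_def lborel_distr_orthogonal_transformation[OF f(1)])
    also have "\<dots> = (LINT x|lborel. indicator (cball 0 1) (f x) *\<^sub>R \<bar>f u \<bullet> f x\<bar>)"
    proof (rule integral_distr)
      show "f \<in> lborel \<rightarrow>\<^sub>M borel"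
        using borel_measurable_continuous_onI[OF contf] by simp
      have "indicator (cball 0 1) \<in> borel_measurable (borel :: 'a measure)"
        by (rule borel_measurable_indicator) simp
      moreover have "(\<lambda>x. \<bar>f u \<bullet> x\<bar>) \<in> borel_measurable borel"
        by (intro borel_measurable_continuous_onI continuous_intros)
      ultimately show "(\<lambda>x. indicator (cball 0 1) x *\<^sub>R \<bar>f u \<bullet> x\<bar>) \<in> borel_measurable borel"
        by (rule borel_measurable_scaleR)
    qed
    also have "\<dots> = I u"
      using f(1) by (simp add: I_def set_lebesgue_integral_def indicator_def orthogonal_transformation_def
          orthogonal_transformation_norm)
    finally have "I u = I (norm u *\<^sub>R e)"
      using f(2) by simp
    also have "\<dots> = I e * norm u"
      by (simp add: I_def abs_mult)
    finally show ?thesis .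
  qed
  moreover have "0 < I e"
  proof -
    \<comment> \<open>A small ball that avoids the hyperplane on which the integrand vanishes.\<close>
    define D where "D = cball ((1 / 2) *\<^sub>R e) (1 / 4)"
    have sub: "D \<subseteq> cball 0 1"
      unfolding D_def using e by (intro cball_subset_cball_iff[THEN iffD2]) (simp add: dist_norm)
    have ge: "1 / 4 \<le> \<bar>e \<bullet> x\<bar>" if "x \<in> D" for x
    proof -
      have "\<bar>e \<bullet> ((1 / 2) *\<^sub>R e - x)\<bar> \<le> norm e * norm ((1 / 2) *\<^sub>R e - x)"
        by (rule Cauchy_Schwarz_ineq2)
      also have "\<dots> \<le> 1 / 4"
        using that e by (simp add: D_def dist_norm)
      finally have "\<bar>e \<bullet> ((1 / 2) *\<^sub>R e - x)\<bar> \<le> 1 / 4" .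
      moreover have "e \<bullet> ((1 / 2) *\<^sub>R e - x) = 1 / 2 - e \<bullet> x"
        using e by (simp add: inner_diff_right norm_eq_1)
      ultimately show ?thesis by linarith
    qed
    have "0 < measure lborel D * (1 / 4)"
      by (simp add: D_def)
    also have "\<dots> = (LINT x:D|lborel. 1 / 4)"
      using emeasure_bounded_finite[of D] by (subst set_integral_const) (auto simp: D_def)
    also have "\<dots> \<le> (LINT x:D|lborel. \<bar>e \<bullet> x\<bar>)"
    proof (rule set_integral_mono)
      show "set_integrable lborel D (\<lambda>x. 1 / 4 :: real)"
        unfolding set_integrable_def by (intro borel_integrable_compact continuous_intros) (auto simp: D_def)
      show "set_integrable lborel D (\<lambda>x. \<bar>e \<bullet> x\<bar>)"
        by (intro set_integrable_abs_inner) (auto simp: D_def)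
    qed (use ge in auto)
    also have "\<dots> \<le> I e"
      unfolding I_def using sub set_integrable_abs_inner[of D e] set_integrable_abs_inner[of "cball 0 1" e]
      unfolding set_lebesgue_integral_def set_integrable_def
      by (intro integral_mono) (auto simp: D_def indicator_def)
    finally show ?thesis .
  qed
  ultimately show ?thesis
    using that[of "I e"] unfolding I_def by blast
qed

text \<open>Together with the next lemma: the support function of a zonotope at \<open>u\<close> is \<open>\<Sum>z\<leftarrow>zs. \<bar>u \<bullet> z\<bar>\<close>.\<close>

lemma inner_zonotope_le:
  assumes "x \<in> zonotope zs"
  shows "u \<bullet> x \<le> (\<Sum>z\<leftarrow>zs. \<bar>u \<bullet> z\<bar>)"
  using assms
proof (induction zs arbitrary: x)
  case (Cons z zs)
  then obtain s y where sy: "s \<in> symmetric_segment z" "y \<in> zonotope zs" "x = s + y"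
    by (auto elim!: set_plus_elim)
  then obtain t where t: "0 \<le> t" "t \<le> 1" "s = (1 - t) *\<^sub>R (- z) + t *\<^sub>R z"
    by (auto simp: symmetric_segment_def in_segment)
  have "u \<bullet> s = (1 - t) * (- (u \<bullet> z)) + t * (u \<bullet> z)"
    by (simp add: t(3) inner_add_right inner_diff_right)
  also have "\<dots> \<le> \<bar>u \<bullet> z\<bar>"
    using t(1,2) by (intro convex_bound_le) auto
  finally have "u \<bullet> s \<le> \<bar>u \<bullet> z\<bar>" .
  then show ?case
    using sy Cons.IH[OF sy(2)] by (simp add: inner_add_right)
qed simp

lemma inner_zonotope_attained:
  "\<exists>x\<in>zonotope zs. u \<bullet> x = (\<Sum>z\<leftarrow>zs. \<bar>u \<bullet> z\<bar>)"
proof (induction zs)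
  case (Cons z zs)
  then obtain y where y: "y \<in> zonotope zs" "u \<bullet> y = (\<Sum>z\<leftarrow>zs. \<bar>u \<bullet> z\<bar>)"
    by blast
  define s where "s = (if 0 \<le> u \<bullet> z then z else - z)"
  have "s \<in> symmetric_segment z"
    by (simp add: s_def symmetric_segment_def)
  then have "s + y \<in> zonotope (z # zs)"
    using y(1) by (simp add: set_plus_intro)
  moreover have "u \<bullet> (s + y) = (\<Sum>z\<leftarrow>z # zs. \<bar>u \<bullet> z\<bar>)"
    using y(2) by (simp add: s_def inner_add_right)
  ultimately show ?case by blast
qed simp

text \<open>A Riemann sum of the integral over the unit ball is the support function of a zonotope and differs
from \<open>c * norm u\<close> by at most a small multiple of \<open>norm u\<close>.  After rescaling it lies between those of
the two balls, and inclusion of compact convex sets can be read off from support functions.\<close>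

lemma zonotope_between_balls:
  fixes \<delta> :: real
  assumes "0 < \<delta>"
  obtains zs :: "'a::euclidean_space list"
  where "cball 0 1 \<subseteq> zonotope zs" "zonotope zs \<subseteq> cball 0 (1 + \<delta>)"
proof -
  obtain c where c: "0 < c"
    "\<And>u :: 'a. (LINT x:cball 0 1|lborel. \<bar>u \<bullet> x\<bar>) = c * norm u"
    using integral_cball_abs_inner by blast
  define V where "V = measure lborel (cball (0::'a) 1)"
  have "0 < V"
    by (simp add: V_def)
  \<comment> \<open>The solution of \<open>(c + \<eta> * V) / (c - \<eta> * V) = 1 + \<delta>\<close>.\<close>
  define \<eta> where "\<eta> = c * \<delta> / (2 + \<delta>) / V"
  have \<eta>: "0 < \<eta>" "\<eta> * V = c * \<delta> / (2 + \<delta>)"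
    using c(1) assms \<open>0 < V\<close> by (simp_all add: \<eta>_def)
  obtain F where F: "finite F" "cball (0::'a) 1 \<subseteq> (\<Union>y\<in>F. ball y \<eta>)"
    using compact_eq_totally_bounded[THEN iffD1, OF compact_cball[of "0::'a" 1]] \<eta>(1) by blast
  obtain w where w: "\<And>y. 0 \<le> w y"
    "\<And>u. \<bar>(\<Sum>y\<in>F. w y * \<bar>u \<bullet> y\<bar>) - c * norm u\<bar> \<le> \<eta> * norm u * V"
    using riemann_sum_abs_inner[OF F(1) _ _ F(2)] c(2) by (auto simp: V_def)
  obtain ys where ys: "set ys = F" "distinct ys"
    using finite_distinct_list[OF F(1)] by blast
  define m where "m = c - \<eta> * V"
  have m: "0 < m" "m * (1 + \<delta>) = c + \<eta> * V"
    using c(1) assms unfolding m_def \<eta>(2) by (simp_all add: field_simps)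
  define zs where "zs = map (\<lambda>y. (w y / m) *\<^sub>R y) ys"
  have "m * (\<Sum>z\<leftarrow>zs. \<bar>u \<bullet> z\<bar>) = (\<Sum>y\<in>F. w y * \<bar>u \<bullet> y\<bar>)" for u
    using m(1) w(1) ys
    by (simp add: zs_def o_def abs_mult sum_list_distinct_conv_sum_set sum_distrib_left)
  then have h: "m * norm u \<le> m * (\<Sum>z\<leftarrow>zs. \<bar>u \<bullet> z\<bar>)"
    "m * (\<Sum>z\<leftarrow>zs. \<bar>u \<bullet> z\<bar>) \<le> m * ((1 + \<delta>) * norm u)" for u
    using w(2)[of u] unfolding mult.assoc[symmetric] m(2) by (simp_all add: m_def abs_le_iff algebra_simps)
  have low: "norm u \<le> (\<Sum>z\<leftarrow>zs. \<bar>u \<bullet> z\<bar>)" and up: "(\<Sum>z\<leftarrow>zs. \<bar>u \<bullet> z\<bar>) \<le> (1 + \<delta>) * norm u" for u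
    using h[of u] m(1) by simp_all
  have "cball 0 1 \<subseteq> zonotope zs"
  proof
    fix x :: 'a assume x: "x \<in> cball 0 1"
    show "x \<in> zonotope zs"
    proof (rule ccontr)
      assume "x \<notin> zonotope zs"
      then obtain a b where ab: "a \<bullet> x < b" "\<And>y. y \<in> zonotope zs \<Longrightarrow> b < a \<bullet> y"
        using separating_hyperplane_closed_point[OF convex_zonotope compact_imp_closed[OF compact_zonotope]]
        by blast
      obtain y where "y \<in> zonotope zs" "(- a) \<bullet> y = (\<Sum>z\<leftarrow>zs. \<bar>(- a) \<bullet> z\<bar>)"
        using inner_zonotope_attained by blast
      then have "norm a < (- a) \<bullet> x"
        using ab(1) ab(2)[of y] low[of "- a"] by simp
      also have "\<dots> \<le> norm a * norm x"
        using norm_cauchy_schwarz[of "- a" x] by simp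
      also have "\<dots> \<le> norm a"
        using x by (simp add: mult_left_le)
      finally show False by simp
    qed
  qed
  moreover have "zonotope zs \<subseteq> cball 0 (1 + \<delta>)"
  proof
    fix x assume "x \<in> zonotope zs"
    then have "x \<bullet> x \<le> (1 + \<delta>) * norm x"
      using inner_zonotope_le[of x zs x] up[of x] by linarith
    then have "norm x * norm x \<le> (1 + \<delta>) * norm x"
      by (simp add: dot_square_norm power2_eq_square)
    then have "norm x \<le> 1 + \<delta>"
      using assms by (cases "x = 0") auto
    then show "x \<in> cball 0 (1 + \<delta>)" by simp
  qed
  ultimately show ?thesis
    using that by blast
qed

section \<open>Steiner's formula and monotonicity of intrinsic volumes\<close>

lemma measure_lebesgue_scaleR:
  fixes S :: "'a::euclidean_space set"
  assumes "0 \<le> c"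
  shows "measure lebesgue ((*\<^sub>R) c ` S) = c ^ DIM('a) * measure lebesgue S"
  using measure_lebesgue_affine[of c 0 S] assms by simp

text \<open>The degree is a priori the number of segments.  As the coefficients are nonnegative, each of them is
controlled by the growth of the volume, which is that of \<open>\<epsilon> ^ DIM('a)\<close>; the higher ones vanish.\<close>

lemma measure_add_zonotope_polynomial:
  obtains \<psi> :: "nat \<Rightarrow> 'a::euclidean_space set \<Rightarrow> real"
  where "\<And>j. segment_affine (\<psi> j)"
    "\<And>K \<epsilon>. compact K \<Longrightarrow> convex K \<Longrightarrow> 0 \<le> \<epsilon> \<Longrightarrow>
      measure lebesgue (K + (*\<^sub>R) \<epsilon> ` zonotope zs) = (\<Sum>j\<le>DIM('a). \<psi> j K * \<epsilon> ^ j)"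
proof -
  let ?d = "DIM('a)" and ?n = "length zs"
  obtain \<psi> :: "nat \<Rightarrow> 'a set \<Rightarrow> real" where \<psi>: "\<And>j. segment_affine (\<psi> j)"
    and poly: "\<And>K \<epsilon>. compact K \<Longrightarrow> convex K \<Longrightarrow> 0 \<le> \<epsilon> \<Longrightarrow>
      measure lebesgue (K + (*\<^sub>R) \<epsilon> ` zonotope zs) = (\<Sum>j\<le>?n. \<psi> j K * \<epsilon> ^ j)"
    using segment_affine_zonotope_polynomial[OF segment_affine_measure, of zs] by blast
  have vanish: "\<psi> j K = 0" if K: "compact K" "convex K" and j: "j \<le> ?n" "?d < j" for j K
  proof (rule ccontr)
    assume "\<psi> j K \<noteq> 0"
    then have pos: "0 < \<psi> j K"
      using \<psi>[of j] K by (simp add: segment_affine_def order_less_le)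
    obtain R S where RS: "\<And>x. x \<in> K \<Longrightarrow> norm x \<le> R" "\<And>x. x \<in> zonotope zs \<Longrightarrow> norm x \<le> S"
      using compact_imp_bounded[OF K(1)] compact_imp_bounded[OF compact_zonotope[of zs]]
      unfolding bounded_iff by blast
    define C where "C = measure lebesgue (cball (0 :: 'a) (\<bar>R\<bar> + \<bar>S\<bar>))"
    have bound: "\<psi> j K * \<epsilon> \<le> C" if "1 \<le> \<epsilon>" for \<epsilon>
    proof -
      have "K + (*\<^sub>R) \<epsilon> ` zonotope zs \<subseteq> (*\<^sub>R) \<epsilon> ` cball 0 (\<bar>R\<bar> + \<bar>S\<bar>)"
      proof
        fix x assume "x \<in> K + (*\<^sub>R) \<epsilon> ` zonotope zs"
        then obtain k z where kz: "k \<in> K" "z \<in> zonotope zs" "x = k + \<epsilon> *\<^sub>R z"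
          by (auto elim!: set_plus_elim)
        have "norm ((1 / \<epsilon>) *\<^sub>R k + z) \<le> (1 / \<epsilon>) * norm k + norm z"
          using norm_triangle_ineq[of "(1 / \<epsilon>) *\<^sub>R k" z] that by simp
        also have "\<dots> \<le> 1 * \<bar>R\<bar> + \<bar>S\<bar>"
          using RS(1)[OF kz(1)] RS(2)[OF kz(2)] that by (intro add_mono mult_mono) auto
        finally show "x \<in> (*\<^sub>R) \<epsilon> ` cball 0 (\<bar>R\<bar> + \<bar>S\<bar>)"
          using kz(3) that by (intro image_eqI[of _ _ "(1 / \<epsilon>) *\<^sub>R k + z"]) (auto simp: scaleR_add_right)
      qed
      then have "measure lebesgue (K + (*\<^sub>R) \<epsilon> ` zonotope zs) \<le>
          measure lebesgue ((*\<^sub>R) \<epsilon> ` cball (0 :: 'a) (\<bar>R\<bar> + \<bar>S\<bar>))"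
        using K(1) by (intro measure_lebesgue_mono_compact compact_set_plus compact_scaling compact_zonotope) auto
      also have "\<dots> = \<epsilon> ^ ?d * C"
        using that unfolding C_def by (intro measure_lebesgue_scaleR) simp
      finally have "(\<Sum>i\<le>?n. \<psi> i K * \<epsilon> ^ i) \<le> \<epsilon> ^ ?d * C"
        using poly[of K \<epsilon>] K that by simp
      moreover have "\<psi> j K * \<epsilon> ^ j \<le> (\<Sum>i\<le>?n. \<psi> i K * \<epsilon> ^ i)"
        using j(1) \<psi> K that
        by (intro member_le_sum) (auto simp: segment_affine_def)
      moreover have "\<psi> j K * \<epsilon> ^ (?d + 1) \<le> \<psi> j K * \<epsilon> ^ j"
        using j(2) that pos by (intro mult_left_mono power_increasing) auto
      ultimately have "\<epsilon> ^ ?d * (\<psi> j K * \<epsilon>) \<le> \<epsilon> ^ ?d * C"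
        by (simp add: algebra_simps)
      then show ?thesis
        using that by simp
    qed
    have "\<psi> j K * max 1 ((C + 1) / \<psi> j K) \<le> C"
      by (rule bound) simp
    moreover have "C + 1 \<le> \<psi> j K * max 1 ((C + 1) / \<psi> j K)"
      using pos by (simp add: max_def field_simps)
    ultimately show False by simp
  qed
  define \<phi> where "\<phi> j = (if j \<le> ?n then \<psi> j else (\<lambda>_. 0))" for j
  have "segment_affine (\<phi> j)" for j
    using \<psi>[of j] by (simp add: \<phi>_def segment_affine_def)
  moreover have "measure lebesgue (K + (*\<^sub>R) \<epsilon> ` zonotope zs) = (\<Sum>j\<le>?d. \<phi> j K * \<epsilon> ^ j)"
    if K: "compact K" "convex K" "0 \<le> \<epsilon>" for K \<epsilon>
    unfolding poly[OF K] using vanish[OF K(1,2)]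
    by (intro sum.mono_neutral_cong) (auto simp: \<phi>_def)
  ultimately show ?thesis
    using that by blast
qed

text \<open>For \<open>k \<in> K\<close>, convexity gives \<open>\<delta> *\<^sub>R k + K \<subseteq> (1 + \<delta>) K\<close>, so a translate of the left body lies in the
dilate of the right one by \<open>1 + \<delta>\<close>.\<close>

lemma measure_add_scaled_cball_le:
  fixes K :: "'a::euclidean_space set"
  assumes K: "compact K" "convex K" "K \<noteq> {}" and "0 \<le> \<delta>"
  shows "measure lebesgue (K + (*\<^sub>R) \<epsilon> ` cball 0 (1 + \<delta>)) \<le>
    (1 + \<delta>) ^ DIM('a) * measure lebesgue (K + (*\<^sub>R) \<epsilon> ` cball 0 1)"
proof -
  obtain k where k: "k \<in> K"
    using K(3) by blast
  have "(+) (\<delta> *\<^sub>R k) ` (K + (*\<^sub>R) \<epsilon> ` cball 0 (1 + \<delta>)) \<subseteq>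
      (*\<^sub>R) (1 + \<delta>) ` (K + (*\<^sub>R) \<epsilon> ` cball 0 1)"
  proof
    fix x assume "x \<in> (+) (\<delta> *\<^sub>R k) ` (K + (*\<^sub>R) \<epsilon> ` cball 0 (1 + \<delta>))"
    then obtain y b where yb: "y \<in> K" "norm b \<le> 1 + \<delta>" "x = \<delta> *\<^sub>R k + (y + \<epsilon> *\<^sub>R b)"
      by (auto elim!: set_plus_elim)
    let ?t = "1 / (1 + \<delta>)"
    define k' where "k' = (\<delta> * ?t) *\<^sub>R k + ?t *\<^sub>R y"
    define b' where "b' = ?t *\<^sub>R b"
    have "k' \<in> K"
      unfolding k'_def using K(2) k yb(1) \<open>0 \<le> \<delta>\<close>
      by (intro convexD) (auto simp flip: add_divide_distrib)
    moreover have "b' \<in> cball 0 1"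
      using yb(2) \<open>0 \<le> \<delta>\<close> by (simp add: b'_def divide_le_eq_1)
    ultimately have "k' + \<epsilon> *\<^sub>R b' \<in> K + (*\<^sub>R) \<epsilon> ` cball 0 1"
      by (intro set_plus_intro imageI)
    moreover have "x = (1 + \<delta>) *\<^sub>R (k' + \<epsilon> *\<^sub>R b')"
    proof -
      have "(1 + \<delta>) *\<^sub>R ?t *\<^sub>R z = z" for z :: 'a
        using \<open>0 \<le> \<delta>\<close> by simp
      moreover have "k' + \<epsilon> *\<^sub>R b' = ?t *\<^sub>R x"
        by (simp add: k'_def b'_def yb(3) scaleR_add_right mult.commute)
      ultimately show ?thesis by simp
    qed
    ultimately show "x \<in> (*\<^sub>R) (1 + \<delta>) ` (K + (*\<^sub>R) \<epsilon> ` cball 0 1)"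
      by blast
  qed
  then have "measure lebesgue ((+) (\<delta> *\<^sub>R k) ` (K + (*\<^sub>R) \<epsilon> ` cball 0 (1 + \<delta>))) \<le>
      measure lebesgue ((*\<^sub>R) (1 + \<delta>) ` (K + (*\<^sub>R) \<epsilon> ` cball (0::'a) 1))"
    using K(1) by (intro measure_lebesgue_mono_compact compact_translation compact_set_plus compact_scaling) auto
  then show ?thesis
    using \<open>0 \<le> \<delta>\<close> by (simp add: measure_translation measure_lebesgue_scaleR)
qed

lemma parallel_body_eq:
  "{a + \<epsilon> *\<^sub>R b |a b. a \<in> A \<and> b \<in> cball 0 1} = A + (*\<^sub>R) \<epsilon> ` cball 0 1"
  unfolding set_plus_def image_def by blast

lemma steiner_coefficientsI:
  fixes A :: "'a::euclidean_space set"
  assumes "\<And>\<epsilon>. 0 \<le> \<epsilon> \<Longrightarrow>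
    measure lebesgue (A + (*\<^sub>R) \<epsilon> ` cball 0 1) = (\<Sum>j\<le>DIM('a). c j * \<epsilon> ^ j)"
  shows "steiner_coefficients A (\<lambda>i. c (DIM('a) - i) / unit_ball_vol (real (DIM('a) - i)))"
  unfolding steiner_coefficients_def
proof (intro allI impI)
  fix \<epsilon> :: real assume "0 \<le> \<epsilon>"
  let ?d = "DIM('a)"
  have "unit_ball_vol (real j) \<noteq> 0" for j
    by (rule less_imp_neq[OF unit_ball_vol_pos, symmetric]) simp
  then have "(\<Sum>i = 0..?d. unit_ball_vol (real (?d - i)) *
      (c (?d - i) / unit_ball_vol (real (?d - i))) * \<epsilon> ^ (?d - i)) = (\<Sum>i = 0..?d. c (?d - i) * \<epsilon> ^ (?d - i))"
    by (simp del: of_nat_diff)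
  also have "\<dots> = (\<Sum>j\<le>?d. c j * \<epsilon> ^ j)"
    by (rule sum.reindex_bij_witness[where i = "\<lambda>j. ?d - j" and j = "\<lambda>j. ?d - j"]) auto
  finally have sum: "(\<Sum>i = 0..?d. unit_ball_vol (real (?d - i)) *
      (c (?d - i) / unit_ball_vol (real (?d - i))) * \<epsilon> ^ (?d - i)) = (\<Sum>j\<le>?d. c j * \<epsilon> ^ j)" .
  show "measure lebesgue {a + \<epsilon> *\<^sub>R b |a b. a \<in> A \<and> b \<in> cball 0 1} =
      (\<Sum>i = 0..?d. unit_ball_vol (real (?d - i)) *
        (c (?d - i) / unit_ball_vol (real (?d - i))) * \<epsilon> ^ (?d - i))"
    unfolding parallel_body_eq using assms[OF \<open>0 \<le> \<epsilon>\<close>] sum by simp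
qed

text \<open>For zonotopes shrinking to the unit ball the volume polynomials converge pointwise to the volume of
the parallel body.  Their coefficients are nonnegative and bounded by the value at \<open>1\<close>, so along a
subsequence, chosen for \<open>K\<close> and \<open>L\<close> simultaneously, they converge; the limits are the Steiner
coefficients, and the inequality between those of \<open>K\<close> and \<open>L\<close> passes to the limit.\<close>

theorem steiner_formula_mono:
  fixes K L :: "'a::euclidean_space set"
  assumes K: "compact K" "convex K" "K \<noteq> {}" and L: "compact L" "convex L" and "K \<subseteq> L"
  shows "\<exists>V W. steiner_coefficients K V \<and> steiner_coefficients L W \<and> (\<forall>i. V i \<le> W i)"
proof -
  let ?d = "DIM('a)"
  define \<delta> where "\<delta> n = inverse (real (Suc n))" for n
  have \<delta>: "0 < \<delta> n" "\<delta> n \<le> 1" for n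
    by (simp_all add: \<delta>_def divide_simps)
  have "\<exists>zs. cball (0::'a) 1 \<subseteq> zonotope zs \<and> zonotope zs \<subseteq> cball 0 (1 + \<delta> n)" for n
    by (rule zonotope_between_balls[OF \<delta>(1)[of n]]) blast
  then obtain zs where zs: "\<And>n. cball (0::'a) 1 \<subseteq> zonotope (zs n)"
    "\<And>n. zonotope (zs n) \<subseteq> cball 0 (1 + \<delta> n)"
    by metis
  have "\<exists>\<psi> :: nat \<Rightarrow> 'a set \<Rightarrow> real. (\<forall>j. segment_affine (\<psi> j)) \<and>
    (\<forall>K \<epsilon>. compact K \<longrightarrow> convex K \<longrightarrow> 0 \<le> \<epsilon> \<longrightarrow>
      measure lebesgue (K + (*\<^sub>R) \<epsilon> ` zonotope (zs n)) = (\<Sum>j\<le>?d. \<psi> j K * \<epsilon> ^ j))" for n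
    by (rule measure_add_zonotope_polynomial[of "zs n"]) blast
  then obtain \<psi> :: "nat \<Rightarrow> nat \<Rightarrow> 'a set \<Rightarrow> real" where \<psi>: "\<And>n j. segment_affine (\<psi> n j)"
    and poly: "\<And>n K \<epsilon>. compact K \<Longrightarrow> convex K \<Longrightarrow> 0 \<le> \<epsilon> \<Longrightarrow>
      measure lebesgue (K + (*\<^sub>R) \<epsilon> ` zonotope (zs n)) = (\<Sum>j\<le>?d. \<psi> n j K * \<epsilon> ^ j)"
    by metis
  have body: "compact A" "convex A" "A \<noteq> {}" if "A \<in> {K, L}" for A
    using that assms by auto
  have limit: "(\<lambda>n. \<Sum>j\<le>?d. \<psi> n j A * \<epsilon> ^ j) \<longlonglongrightarrow> measure lebesgue (A + (*\<^sub>R) \<epsilon> ` cball 0 1)"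
    if A: "A \<in> {K, L}" and "0 \<le> \<epsilon>" for A \<epsilon>
  proof (rule tendsto_sandwich)
    let ?v = "measure lebesgue (A + (*\<^sub>R) \<epsilon> ` cball 0 1)"
    have comp: "compact (A + (*\<^sub>R) \<epsilon> ` zonotope (zs n))" "compact (A + (*\<^sub>R) \<epsilon> ` cball 0 r)" for n r
      using body[OF A] by (intro compact_set_plus compact_scaling compact_zonotope compact_cball; simp)+
    show "\<forall>\<^sub>F n in sequentially. ?v \<le> (\<Sum>j\<le>?d. \<psi> n j A * \<epsilon> ^ j)"
      unfolding poly[OF body(1,2)[OF A] \<open>0 \<le> \<epsilon>\<close>, symmetric] using zs(1) comp
      by (intro always_eventually allI measure_lebesgue_mono_compact set_plus_mono2 image_mono) auto
    show "\<forall>\<^sub>F n in sequentially. (\<Sum>j\<le>?d. \<psi> n j A * \<epsilon> ^ j) \<le> (1 + \<delta> n) ^ ?d * ?v"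
    proof (intro always_eventually allI)
      fix n
      have "measure lebesgue (A + (*\<^sub>R) \<epsilon> ` zonotope (zs n)) \<le>
          measure lebesgue (A + (*\<^sub>R) \<epsilon> ` cball 0 (1 + \<delta> n))"
        using zs(2) comp by (intro measure_lebesgue_mono_compact set_plus_mono2 image_mono) auto
      also have "\<dots> \<le> (1 + \<delta> n) ^ ?d * ?v"
        using body[OF A] \<delta>(1)[of n] by (intro measure_add_scaled_cball_le) auto
      finally show "(\<Sum>j\<le>?d. \<psi> n j A * \<epsilon> ^ j) \<le> (1 + \<delta> n) ^ ?d * ?v"
        using poly[OF body(1,2)[OF A] \<open>0 \<le> \<epsilon>\<close>] by simp
    qed
    have "\<delta> \<longlonglongrightarrow> 0"
      unfolding \<delta>_def[abs_def] by (rule LIMSEQ_inverse_real_of_nat)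
    then have "(\<lambda>n. (1 + \<delta> n) ^ ?d * ?v) \<longlonglongrightarrow> (1 + 0) ^ ?d * ?v"
      by (intro tendsto_intros)
    then show "(\<lambda>n. (1 + \<delta> n) ^ ?d * ?v) \<longlonglongrightarrow> ?v" by simp
  qed simp
  define f where "f n i = \<psi> n (fst i) (snd i)" for n and i :: "nat \<times> 'a set"
  define I where "I = {..?d} \<times> {K, L}"
  have bdd: "bounded ((\<lambda>x. x i) ` range f)" if "i \<in> I" for i
  proof -
    obtain j A where "i = (j, A)"
      by (cases i)
    then have i: "i = (j, A)" "j \<le> ?d" "A \<in> {K, L}"
      using that by (simp_all add: I_def)
    have "Bseq (\<lambda>n. \<Sum>j\<le>?d. \<psi> n j A * 1 ^ j)"
      using limit[OF i(3), of 1] by (intro convergent_imp_Bseq convergentI) auto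
    then obtain B where B: "\<And>n. norm (\<Sum>j\<le>?d. \<psi> n j A * 1 ^ j) \<le> B"
      unfolding Bseq_def by blast
    have "norm (f n i) \<le> B" for n
    proof -
      have nonneg: "0 \<le> \<psi> n j A" for j
        using \<psi>[of n j] body[OF i(3)] by (simp add: segment_affine_def)
      then have "\<psi> n j A \<le> (\<Sum>j\<le>?d. \<psi> n j A)"
        using i(2) by (intro member_le_sum) auto
      then show ?thesis
        using B[of n] nonneg[of j] by (simp add: f_def i(1))
    qed
    then show ?thesis
      by (auto simp: bounded_iff)
  qed
  have "finite I"
    by (simp add: I_def)
  then have "\<forall>J\<subseteq>I. \<exists>l r. strict_mono (r :: nat \<Rightarrow> nat) \<and>
      (\<forall>e>0. \<forall>\<^sub>F n in sequentially. \<forall>i\<in>J. dist (f (r n) i) (l i) < e)"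
    by (rule compact_lemma_general[where unproj = "\<lambda>x. x"]) (use bdd in simp_all)
  then obtain l r where r: "strict_mono (r :: nat \<Rightarrow> nat)"
    and lr: "\<forall>e>0. \<forall>\<^sub>F n in sequentially. \<forall>i\<in>I. dist (f (r n) i) (l i) < e"
    by (meson subset_refl)
  have l: "(\<lambda>n. f (r n) i) \<longlonglongrightarrow> l i" if "i \<in> I" for i
  proof (rule tendstoI)
    fix e :: real assume "0 < e"
    then have "\<forall>\<^sub>F n in sequentially. \<forall>i\<in>I. dist (f (r n) i) (l i) < e"
      using lr by blast
    then show "\<forall>\<^sub>F n in sequentially. dist (f (r n) i) (l i) < e"
      by (rule eventually_mono) (use that in blast)
  qed
  have conv: "(\<lambda>n. \<psi> (r n) j A) \<longlonglongrightarrow> l (j, A)" if "j \<le> ?d" "A \<in> {K, L}" for j A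
    using l[of "(j, A)"] that by (simp add: f_def I_def)
  have steiner: "steiner_coefficients A (\<lambda>i. l (?d - i, A) / unit_ball_vol (real (?d - i)))"
    if A: "A \<in> {K, L}" for A
  proof (rule steiner_coefficientsI)
    fix \<epsilon> :: real assume "0 \<le> \<epsilon>"
    have "(\<lambda>n. \<Sum>j\<le>?d. \<psi> (r n) j A * \<epsilon> ^ j) \<longlonglongrightarrow> (\<Sum>j\<le>?d. l (j, A) * \<epsilon> ^ j)"
      using A by (intro tendsto_sum tendsto_mult tendsto_const conv) auto
    moreover have "(\<lambda>n. \<Sum>j\<le>?d. \<psi> (r n) j A * \<epsilon> ^ j) \<longlonglongrightarrow> measure lebesgue (A + (*\<^sub>R) \<epsilon> ` cball 0 1)"
      using LIMSEQ_subseq_LIMSEQ[OF limit[OF A \<open>0 \<le> \<epsilon>\<close>] r] by (simp add: o_def)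
    ultimately show "measure lebesgue (A + (*\<^sub>R) \<epsilon> ` cball 0 1) = (\<Sum>j\<le>?d. l (j, A) * \<epsilon> ^ j)"
      using LIMSEQ_unique by blast
  qed
  have "l (j, K) \<le> l (j, L)" if "j \<le> ?d" for j
  proof (rule LIMSEQ_le[OF conv[OF that] conv[OF that]])
    have "\<psi> (r n) j K \<le> \<psi> (r n) j L" for n
      using \<psi>[of "r n" j] assms by (simp add: segment_affine_def)
    then show "\<exists>N. \<forall>n\<ge>N. \<psi> (r n) j K \<le> \<psi> (r n) j L"
      by blast
  qed auto
  then have "l (?d - i, K) / unit_ball_vol (real (?d - i)) \<le> l (?d - i, L) / unit_ball_vol (real (?d - i))" for i
    by (intro divide_right_mono) auto
  then show ?thesis
    using steiner[of K] steiner[of L] by blast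
qed

corollary intrinsic_volume_mono:
  fixes K L :: "'a::euclidean_space set"
  assumes "compact K" "convex K" "K \<noteq> {}" "compact L" "convex L" "K \<subseteq> L" "k \<le> DIM('a)"
  shows "intrinsic_volume k K \<le> intrinsic_volume k L"
proof -
  obtain V W where "steiner_coefficients K V" "steiner_coefficients L W" "\<And>i. V i \<le> W i"
    using steiner_formula_mono[of K L] assms by blast
  then show ?thesis
    using intrinsic_volume_eqI assms(7) by metis
qed

lemma intrinsic_volume_congruent:
  fixes A :: "'a::euclidean_space set" and f :: "'a \<Rightarrow> 'a"
  assumes f: "orthogonal_transformation f" and "compact A"
  shows "intrinsic_volume k ((\<lambda>x. c + f x) ` A) = intrinsic_volume k A"
proof -
  have "measure lebesgue {a + \<epsilon> *\<^sub>R b |a b. a \<in> (\<lambda>x. c + f x) ` A \<and> b \<in> cball 0 1} =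
      measure lebesgue {a + \<epsilon> *\<^sub>R b |a b. a \<in> A \<and> b \<in> cball 0 1}" for \<epsilon>
  proof -
    have lin: "linear f"
      using f by (rule orthogonal_transformation_linear)
    have ball: "f ` cball 0 1 = cball 0 1"
      using image_orthogonal_transformation_cball[OF f, of 0 1] linear_0[OF lin] by simp
    have "(\<lambda>x. c + f x) ` A + (*\<^sub>R) \<epsilon> ` cball 0 1 = (+) c ` f ` (A + (*\<^sub>R) \<epsilon> ` cball 0 1)"
    proof (intro equalityI subsetI)
      fix x assume "x \<in> (\<lambda>x. c + f x) ` A + (*\<^sub>R) \<epsilon> ` cball 0 1"
      then have "x \<in> (\<lambda>x. c + f x) ` A + (*\<^sub>R) \<epsilon> ` f ` cball 0 1"
        by (simp only: ball)
      then obtain a b where ab: "a \<in> A" "b \<in> cball 0 1" "x = (c + f a) + \<epsilon> *\<^sub>R f b"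
        by (auto elim!: set_plus_elim simp del: mem_cball mem_cball_0)
      then have "x = c + f (a + \<epsilon> *\<^sub>R b)"
        by (simp add: linear_add[OF lin] linear_scale[OF lin])
      then show "x \<in> (+) c ` f ` (A + (*\<^sub>R) \<epsilon> ` cball 0 1)"
        using set_plus_intro[OF ab(1) imageI[OF ab(2)]] by blast
    next
      fix x assume "x \<in> (+) c ` f ` (A + (*\<^sub>R) \<epsilon> ` cball 0 1)"
      then obtain a b where ab: "a \<in> A" "b \<in> cball 0 1" "x = c + f (a + \<epsilon> *\<^sub>R b)"
        by (auto elim!: set_plus_elim simp del: mem_cball mem_cball_0)
      then have "x = (c + f a) + \<epsilon> *\<^sub>R f b"
        by (simp add: linear_add[OF lin] linear_scale[OF lin])
      moreover have "f b \<in> cball 0 1"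
        using ab(2) ball by blast
      then have "\<epsilon> *\<^sub>R f b \<in> (*\<^sub>R) \<epsilon> ` cball 0 1"
        by (rule imageI)
      moreover have "c + f a \<in> (\<lambda>x. c + f x) ` A"
        using ab(1) by (rule imageI)
      ultimately show "x \<in> (\<lambda>x. c + f x) ` A + (*\<^sub>R) \<epsilon> ` cball 0 1"
        by (simp only: set_plus_intro)
    qed
    moreover have "compact (A + (*\<^sub>R) \<epsilon> ` cball 0 1)"
      using assms(2) by (intro compact_set_plus compact_scaling) auto
    ultimately show ?thesis
      unfolding parallel_body_eq by (simp add: measure_translation measure_orthogonal_transformation_compact[OF f])
  qed
  then show ?thesis
    by (simp add: intrinsic_volume_def steiner_coefficients_def)
qed

section \<open>Jung's theorem\<close>

text \<open>The infimum defining the circumradius is attained: the pairs of a centre and a radius of balls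
containing \<open>X\<close>, with an upper bound on the radius, form a compact set.\<close>

lemma circumball_exists:
  fixes X :: "'a::euclidean_space set"
  assumes "finite X" "X \<noteq> {}"
  obtains c where "X \<subseteq> cball c (circumradius X)" "0 \<le> circumradius X"
    "\<And>c' R. X \<subseteq> cball c' R \<Longrightarrow> circumradius X \<le> R"
proof -
  obtain x0 where x0: "x0 \<in> X"
    using assms(2) by blast
  obtain R0 where R0: "X \<subseteq> cball x0 R0" "0 \<le> R0"
    using finite_imp_bounded[OF assms(1)] bounded_subset_ballD[of X x0] by (metis ball_subset_cball less_imp_le subset_trans)
  define D where "D = {(c, R). 0 \<le> R \<and> R \<le> R0 \<and> X \<subseteq> cball c R}"
  have "closed D"
  proof -
    have "D = {p. 0 \<le> snd p} \<inter> {p. snd p \<le> R0} \<inter> (\<Inter>x\<in>X. {p. dist (fst p) x \<le> snd p})"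
      by (auto simp: D_def)
    then show ?thesis
      by (auto intro!: closed_Int closed_INT closed_Collect_le continuous_intros)
  qed
  moreover have "bounded D"
  proof (rule bounded_subset)
    show "D \<subseteq> cball x0 R0 \<times> {0..R0}"
      using x0 by (auto simp: D_def dist_commute)
    show "bounded (cball x0 R0 \<times> {0..R0})"
      by (intro bounded_Times) auto
  qed
  moreover have "D \<noteq> {}"
    using R0 by (auto simp: D_def)
  ultimately obtain p where p: "p \<in> D" "\<And>q. q \<in> D \<Longrightarrow> snd p \<le> snd q"
    using continuous_attains_inf[of D snd] by (auto simp: compact_eq_bounded_closed continuous_on_snd)
  obtain c R where cR: "p = (c, R)" "0 \<le> R" "R \<le> R0" "X \<subseteq> cball c R"
    using p(1) by (auto simp: D_def)
  have min: "R \<le> R'" if "X \<subseteq> cball c' R'" for c' R'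
  proof (cases "R' \<le> R0")
    case True
    have "0 \<le> R'"
      using x0 that by (metis cball_empty empty_iff not_le subset_empty subsetD)
    then show ?thesis
      using p(2)[of "(c', R')"] True that cR(1) by (simp add: D_def)
  qed (use cR in simp)
  have "circumradius X = R"
    unfolding circumradius_def
  proof (rule cInf_eq_minimum)
    show "R \<in> {R. 0 \<le> R \<and> (\<exists>c. X \<subseteq> cball c R)}"
      using cR by blast
    show "\<And>R'. R' \<in> {R. 0 \<le> R \<and> (\<exists>c. X \<subseteq> cball c R)} \<Longrightarrow> R \<le> R'"
      using min by blast
  qed
  then show ?thesis
    using that[of c] cR min by simp
qed

text \<open>Otherwise a hyperplane separates the centre from the points of \<open>X\<close> on the sphere; moving the centre
a little towards them brings all of \<open>X\<close> strictly inside a ball of radius \<open>R\<close>, and the ball could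
be shrunk.\<close>

lemma circumcentre_in_hull_of_contact:
  fixes X :: "'a::euclidean_space set"
  assumes "finite X" "X \<noteq> {}" and X: "X \<subseteq> cball c R" and min: "\<And>c' R'. X \<subseteq> cball c' R' \<Longrightarrow> R \<le> R'"
  shows "c \<in> convex hull {x \<in> X. dist c x = R}"
proof (rule ccontr)
  let ?T = "{x \<in> X. dist c x = R}"
  assume "c \<notin> convex hull ?T"
  moreover have "closed (convex hull ?T)"
    using assms(1) by (simp add: compact_imp_closed finite_imp_compact_convex_hull)
  ultimately obtain a b where ab: "a \<bullet> c < b" "\<And>x. x \<in> convex hull ?T \<Longrightarrow> b < a \<bullet> x"
    using separating_hyperplane_closed_point[of "convex hull ?T" c] by auto
  have closer: "\<forall>\<^sub>F t in at_right 0. dist (c + t *\<^sub>R a) x < R" if "x \<in> X" for x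
  proof (cases "dist c x = R")
    case False
    then have "dist c x < R"
      using X that by auto
    moreover have "((\<lambda>t. dist (c + t *\<^sub>R a) x) \<longlongrightarrow> dist (c + 0 *\<^sub>R a) x) (at_right 0)"
      by (intro tendsto_intros)
    ultimately show ?thesis
      using order_tendstoD(2) by fastforce
  next
    case True
    then have pos: "0 < a \<bullet> (x - c)"
      using ab(1) ab(2)[OF hull_inc, of x] that by (simp add: inner_diff_right)
    have "((\<lambda>t. t * (a \<bullet> a)) \<longlongrightarrow> 0 * (a \<bullet> a)) (at_right (0::real))"
      by (intro tendsto_intros)
    then have "\<forall>\<^sub>F t in at_right 0. t * (a \<bullet> a) < 2 * (a \<bullet> (x - c))"
      using order_tendstoD(2)[where a = "2 * (a \<bullet> (x - c))"] pos by fastforce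
    moreover have "\<forall>\<^sub>F t in at_right (0::real). 0 < t"
      by (simp add: eventually_at_right_less)
    ultimately show ?thesis
    proof eventually_elim
      case (elim t)
      have "(dist (c + t *\<^sub>R a) x)\<^sup>2 = (dist c x)\<^sup>2 + t * (t * (a \<bullet> a) - 2 * (a \<bullet> (x - c)))"
        unfolding dist_norm power2_norm_eq_inner by (simp add: inner_simps inner_commute algebra_simps)
      also have "\<dots> < R\<^sup>2"
        using elim True by (simp add: mult_pos_neg)
      finally show ?case
        using True zero_le_dist[of c x] by (metis power2_less_imp_less)
    qed
  qed
  then have "\<forall>\<^sub>F t in at_right 0. \<forall>x\<in>X. dist (c + t *\<^sub>R a) x < R"
    using assms(1) by (simp add: eventually_ball_finite)
  then obtain t where t: "\<And>x. x \<in> X \<Longrightarrow> dist (c + t *\<^sub>R a) x < R"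
    using eventually_happens'[OF trivial_limit_at_right_real] by blast
  define R' where "R' = Max ((\<lambda>x. dist (c + t *\<^sub>R a) x) ` X)"
  have "X \<subseteq> cball (c + t *\<^sub>R a) R'"
    using assms(1) by (auto simp: R'_def)
  moreover have "R' < R"
    using t assms(1,2) by (simp add: R'_def)
  ultimately show False
    using min by fastforce
qed

text \<open>Jung's theorem.  By Caratheodory the circumcentre is a convex combination of at most \<open>DIM('a) + 1\<close>
points on the sphere, and some \<open>y\<close> among them has weight at least \<open>1 / (DIM('a) + 1)\<close>.  The weighted mean of
the squared distances to \<open>y\<close> equals twice the squared circumradius; since \<open>y\<close> itself contributes
nothing, some other point must be far from \<open>y\<close>.\<close>

theorem jung:
  fixes X :: "'a::euclidean_space set"
  assumes "finite X" "X \<noteq> {}"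
  obtains x y where "x \<in> X" "y \<in> X"
    "2 * sqrt ((real DIM('a) + 1) / (2 * real DIM('a))) * circumradius X \<le> dist x y"
proof -
  let ?d = "real DIM('a)" and ?R = "circumradius X"
  obtain c where c: "X \<subseteq> cball c ?R" "0 \<le> ?R" "\<And>c' R. X \<subseteq> cball c' R \<Longrightarrow> ?R \<le> R"
    using circumball_exists[OF assms] by blast
  have "c \<in> convex hull {x \<in> X. dist c x = ?R}"
    using circumcentre_in_hull_of_contact[OF assms c(1,3)] .
  then obtain S u where S: "finite S" "S \<subseteq> {x \<in> X. dist c x = ?R}" "card S \<le> DIM('a) + 1"
    "\<And>x. x \<in> S \<Longrightarrow> 0 \<le> u x" "sum u S = 1" "(\<Sum>x\<in>S. u x *\<^sub>R x) = c"
    unfolding convex_hull_caratheodory by auto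
  have "S \<noteq> {}"
    using S(5) by auto
  have "\<exists>y\<in>S. 1 / (?d + 1) \<le> u y"
  proof (rule ccontr)
    assume "\<not> ?thesis"
    then have "sum u S < (\<Sum>y\<in>S. 1 / (?d + 1))"
      using S(1) \<open>S \<noteq> {}\<close> by (intro sum_strict_mono) auto
    also have "\<dots> \<le> 1"
      using S(3) by (simp add: divide_le_eq_1)
    finally show False
      using S(5) by simp
  qed
  then obtain y where y: "y \<in> S" "1 / (?d + 1) \<le> u y"
    by blast
  define q where "q = (\<Sum>x\<in>S. u x * (dist x y)\<^sup>2)"
  have q: "q = 2 * ?R\<^sup>2"
  proof -
    have dist_sq: "(dist x y)\<^sup>2 = 2 * ?R\<^sup>2 - 2 * ((x - c) \<bullet> (y - c))" if "x \<in> S" for x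
    proof -
      have "(dist c x)\<^sup>2 = ?R\<^sup>2" "(dist c y)\<^sup>2 = ?R\<^sup>2"
        using S(2) that y(1) by auto
      moreover have "(dist x y)\<^sup>2 = (dist c x)\<^sup>2 + (dist c y)\<^sup>2 - 2 * ((x - c) \<bullet> (y - c))"
        by (simp add: dist_norm power2_norm_eq_inner inner_simps inner_commute)
      ultimately show ?thesis by simp
    qed
    have "q = (\<Sum>x\<in>S. u x * (2 * ?R\<^sup>2) - 2 * ((u x *\<^sub>R x - u x *\<^sub>R c) \<bullet> (y - c)))"
      unfolding q_def scaleR_right_diff_distrib[symmetric] inner_scaleR_left
      by (intro sum.cong) (simp_all add: dist_sq right_diff_distrib)
    also have "\<dots> = sum u S * (2 * ?R\<^sup>2) - 2 * (((\<Sum>x\<in>S. u x *\<^sub>R x) - sum u S *\<^sub>R c) \<bullet> (y - c))"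
      by (simp add: sum_subtractf sum_distrib_left sum_distrib_right inner_sum_left scaleR_sum_left flip: sum_subtractf)
    finally show ?thesis
      using S(5,6) by simp
  qed
  define D where "D = Max ((\<lambda>x. dist x y) ` S)"
  have D: "dist x y \<le> D" if "x \<in> S" for x
    using S(1) that by (simp add: D_def)
  have "D \<in> (\<lambda>x. dist x y) ` S"
    unfolding D_def using S(1) \<open>S \<noteq> {}\<close> by (intro Max_in) auto
  then obtain x where x: "x \<in> S" "dist x y = D"
    by auto
  have "0 \<le> D"
    using x(2) zero_le_dist[of x y] by simp
  have "q = (\<Sum>x\<in>S - {y}. u x * (dist x y)\<^sup>2)"
    unfolding q_def using S(1) y(1) by (simp add: sum.remove[of S y])
  also have "\<dots> \<le> (\<Sum>x\<in>S - {y}. u x * D\<^sup>2)"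
    using S(4) D by (intro sum_mono mult_left_mono power_mono) auto
  also have "\<dots> = (1 - u y) * D\<^sup>2"
    using S(1,5) y(1) by (simp add: sum.remove[of S y] flip: sum_distrib_right)
  also have "\<dots> \<le> (?d / (?d + 1)) * D\<^sup>2"
    using y(2) by (intro mult_right_mono) (auto simp: field_simps)
  finally have "2 * ?R\<^sup>2 \<le> (?d / (?d + 1)) * D\<^sup>2"
    using q by simp
  then have "4 * ((?d + 1) / (2 * ?d)) * ?R\<^sup>2 \<le> D\<^sup>2"
    by (simp add: field_simps)
  then have "(2 * sqrt ((?d + 1) / (2 * ?d)) * ?R)\<^sup>2 \<le> D\<^sup>2"
    by (simp add: power_mult_distrib)
  then have "2 * sqrt ((?d + 1) / (2 * ?d)) * ?R \<le> D"
    using \<open>0 \<le> D\<close> by (rule power2_le_imp_le)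
  then show ?thesis
    using that[of x y] x y S(2) by auto
qed

section \<open>Lenses and ball bodies\<close>

lemma compact_lens: "compact (cball a r \<inter> cball b r :: 'a::euclidean_space set)"
  by (intro compact_Int) auto

lemma convex_lens: "convex (cball a r \<inter> cball b r :: 'a::euclidean_space set)"
  by (intro convex_Int) auto

text \<open>A point within distance \<open>r\<close> of \<open>x\<close> and of \<open>y\<close> is within distance \<open>r\<close> of the segment between them; \<open>z\<close> is
taken on that segment.\<close>

lemma lens_subset_lens_of_closer_centre:
  fixes x y :: "'a::euclidean_space"
  assumes "0 \<le> s" "s \<le> dist x y"
  obtains z where "dist x z = s" "cball x r \<inter> cball y r \<subseteq> cball x r \<inter> cball z r"
proof -
  obtain z where z: "z \<in> closed_segment x y" "dist x z = s"
  proof (cases "x = y")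
    case False
    let ?t = "s / dist x y"
    let ?z = "(1 - ?t) *\<^sub>R x + ?t *\<^sub>R y"
    have "?z \<in> closed_segment x y"
      unfolding in_segment using assms False by (intro exI[of _ ?t]) auto
    moreover have "x - ?z = ?t *\<^sub>R (x - y)"
      by (simp add: algebra_simps)
    then have "dist x ?z = s"
      using assms False by (simp only: dist_norm norm_scaleR) simp
    ultimately show ?thesis
      using that by blast
  qed (use assms that[of x] in auto)
  have "cball x r \<inter> cball y r \<subseteq> cball z r"
  proof
    fix p assume "p \<in> cball x r \<inter> cball y r"
    then have "{x, y} \<subseteq> cball p r"
      by (simp add: dist_commute)
    then have "closed_segment x y \<subseteq> cball p r"
      by (simp add: closed_segment_subset)
    then show "p \<in> cball z r"
      using z(1) by (auto simp: dist_commute)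
  qed
  then show ?thesis
    using that[of z] z(2) by blast
qed

lemma intrinsic_volume_lens_cong:
  fixes a b x y :: "'a::euclidean_space"
  assumes "dist a b = dist x y"
  shows "intrinsic_volume k (cball a r \<inter> cball b r) = intrinsic_volume k (cball x r \<inter> cball y r)"
proof -
  have "norm (b - a) = norm (y - x)"
    using assms by (simp add: dist_norm norm_minus_commute)
  then obtain f where f: "orthogonal_transformation f" "f (b - a) = y - x"
    by (rule orthogonal_transformation_exists_equal_norm)
  have lin: "linear f"
    using f(1) by (rule orthogonal_transformation_linear)
  define g where "g p = (x - f a) + f p" for p
  have ball: "g ` cball p r = cball (g p) r" for p
  proof -
    have "g ` cball p r = (+) (x - f a) ` f ` cball p r"
      by (simp add: image_image g_def)
    also have "\<dots> = cball (g p) r"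
      by (simp only: image_orthogonal_transformation_cball[OF f(1)] cball_translation g_def)
    finally show ?thesis .
  qed
  have "inj g"
    using orthogonal_transformation_inj[OF f(1)] by (simp add: g_def inj_def)
  have "g a = x" "g b = y"
    using f(2) by (simp_all add: g_def linear_diff[OF lin] algebra_simps)
  then have "g ` (cball a r \<inter> cball b r) = cball x r \<inter> cball y r"
    using image_Int[OF \<open>inj g\<close>] ball by metis
  then show ?thesis
    using intrinsic_volume_congruent[OF f(1) compact_lens, of k "x - f a" a r b]
    by (simp add: g_def[abs_def])
qed

theorem theorem4:
  fixes r r0 :: real and N k :: nat
    and p :: "nat \<Rightarrow> 'a::euclidean_space" and L :: "'a set"
  assumes "0 < r0" and "r0 < r"
    and "1 < N"
    and "0 < k" and "k < DIM('a)"
    and "circumradius (p ` {1..N}) = r0"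
    and "lens_of_inradius r
           (r - sqrt ((real DIM('a) + 1) / (2 * real DIM('a))) * r0) L"
  shows "intrinsic_volume k (ball_body r (p ` {1..N})) \<le> intrinsic_volume k L"
proof -
  let ?X = "p ` {1..N}" and ?K = "ball_body r (p ` {1..N})"
  define \<sigma> where "\<sigma> = sqrt ((real DIM('a) + 1) / (2 * real DIM('a))) * r0"
  have X: "finite ?X" "?X \<noteq> {}"
    using assms(3) by auto
  have "sqrt ((real DIM('a) + 1) / (2 * real DIM('a))) \<le> 1"
    using assms(4,5) by (simp add: divide_le_eq_1)
  then have "\<sigma> \<le> 1 * r0"
    unfolding \<sigma>_def using assms(1) by (intro mult_right_mono) auto
  then have \<sigma>: "0 \<le> \<sigma>" "\<sigma> < r"
    using assms(1,2) by (simp add: \<sigma>_def, linarith)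
  obtain a b where L: "L = cball a r \<inter> cball b r" "dist a b = 2 * \<sigma>"
    using assms(7) \<sigma>(2) lens_of_inradius_iff[of "r - \<sigma>" r L] by (auto simp: \<sigma>_def)
  obtain x y where xy: "x \<in> ?X" "y \<in> ?X" "2 * \<sigma> \<le> dist x y"
    using jung[OF X] assms(6) by (auto simp: \<sigma>_def mult.assoc)
  obtain z where z: "dist x z = 2 * \<sigma>" "cball x r \<inter> cball y r \<subseteq> cball x r \<inter> cball z r"
    using lens_subset_lens_of_closer_centre[OF _ xy(3)] \<sigma>(1) by auto
  obtain c where c: "?X \<subseteq> cball c r0"
    using circumball_exists[OF X] assms(6) by metis
  have "c \<in> ?K"
    using c assms(2) unfolding ball_body_def by (force simp: dist_commute)
  then have "?K \<noteq> {}"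
    by blast
  moreover have "compact ?K"
    unfolding ball_body_def using X by (intro compact_Inter) auto
  moreover have "convex ?K"
    unfolding ball_body_def by (intro convex_INT) auto
  moreover have "?K \<subseteq> cball x r \<inter> cball z r"
    using xy(1,2) z(2) unfolding ball_body_def by blast
  ultimately have "intrinsic_volume k ?K \<le> intrinsic_volume k (cball x r \<inter> cball z r)"
    using assms(5) by (intro intrinsic_volume_mono compact_lens convex_lens) auto
  also have "\<dots> = intrinsic_volume k L"
    unfolding L(1) using L(2) z(1) by (intro intrinsic_volume_lens_cong) simp
  finally show ?thesis .
qed

end
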